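(* A subgroup $H$ of $PL_o(I)$ is non-solvable if and only if $H$ admits towers of arbitrary height (i.e. for every natural number $n$ there is a tower of $H$ of height at least $n$).
   Context: $I=[0,1]$. $PL_o(I)$ is the group, under composition, of orientation-preserving piecewise-linear homeomorphisms of $I$ with finitely many breaks in slope. Elements act on the right. An orbital of a subgroup $G\le PL_o(I)$ is the convex hull of the orbit of a point of $I$ under $G$, provided this set has more than one element; orbitals are open intervals. (Equivalently, orbitals are the connected components of the support of the action of $G$.) An orbital of an element $g$ is an orbital of $\langle g\rangle$. A signed orbital of $G$ is a pair $(A,g)$ with $g\in G$ and $A$ an orbital of $g$. The left total order on $PL_o(I)$: for two distinct elements there is a maximal $x\in[0,1)$ such that they agree on $[0,x]$; the one with the larger right-hand derivative at $x$ is declared the larger. Signed orbitals are partially ordered lexicographically: $(A,g)\le (B,h)$ iff $A\subsetneq B$, or $A=B$ and $g\le h$ in the left total order. A tower of $G$ is a set $T$ of signed orbitals of $G$ such that (1) $T$ is a chain in this partial order, and (2) for each $A$ occurring as the orbital of some element of $T$, $T$ has exactly one element of the form $(A,g)$. The height of a tower is its cardinality. *)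

theory Defs
  imports
    "HOL-Analysis.Analysis"
    "HOL-Algebra.Solvable_Groups"
    "HOL-Algebra.Group_Action"
begin

text \<open>An exceptional point of \<open>piecewise_linear\<close> need not be an actual break.\<close>

definition piecewise_linear :: "(real \<Rightarrow> real) \<Rightarrow> bool" where
  "piecewise_linear f \<longleftrightarrow>
     (\<exists>B. finite B \<and>
       (\<forall>a b. 0 \<le> a \<and> a < b \<and> b \<le> 1 \<and> {a<..<b} \<inter> B = {} \<longrightarrow>
         (\<exists>m c. \<forall>x\<in>{a..b}. f x = m * x + c)))"

text \<open>
  A self-map of the unit interval is represented by its extensional extension to the reals, as in
  \<^const>\<open>BijGroup\<close>. The product follows the right-action convention: \<open>f \<otimes> g\<close> applies \<open>f\<close> first.
\<close>

definition PLo :: "(real \<Rightarrow> real) monoid" where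
  "PLo =
     \<lparr>carrier = {f \<in> extensional {0..1}.
        (\<exists>f'. homeomorphism {0..1} {0..1} f f') \<and> strict_mono_on {0..1} f \<and> piecewise_linear f},
      mult = (\<lambda>f g. compose {0..1} g f),
      one = (\<lambda>x\<in>{0..1}. x)\<rparr>"

text \<open>The set \<^term>\<open>orbit G (\<lambda>f. f) x\<close> is the same for left and right actions.\<close>

definition orbitals :: "(real \<Rightarrow> real) set \<Rightarrow> real set set" where
  "orbitals G =
     {A. \<exists>x\<in>{0..1}. A = convex hull (orbit (PLo\<lparr>carrier := G\<rparr>) (\<lambda>f. f) x) \<and>
           (\<exists>y\<in>A. \<exists>z\<in>A. y \<noteq> z)}"

definition elem_orbitals :: "(real \<Rightarrow> real) \<Rightarrow> real set set" where
  "elem_orbitals g = orbitals (generate PLo {g})"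

type_synonym signed_orbital = "real set \<times> (real \<Rightarrow> real)"

definition signed_orbitals :: "(real \<Rightarrow> real) set \<Rightarrow> signed_orbital set" where
  "signed_orbitals G = {(A, g). g \<in> G \<and> A \<in> elem_orbitals g}"

definition left_less :: "(real \<Rightarrow> real) \<Rightarrow> (real \<Rightarrow> real) \<Rightarrow> bool" where
  "left_less g h \<longleftrightarrow>
     (\<exists>x\<in>{0..<1}.
        (\<forall>t\<in>{0..x}. g t = h t) \<and>
        (\<forall>y\<in>{0..<1}. (\<forall>t\<in>{0..y}. g t = h t) \<longrightarrow> y \<le> x) \<and>
        (\<exists>a b. (g has_real_derivative a) (at_right x) \<and>
               (h has_real_derivative b) (at_right x) \<and> a < b))"

definition left_le :: "(real \<Rightarrow> real) \<Rightarrow> (real \<Rightarrow> real) \<Rightarrow> bool" where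
  "left_le g h \<longleftrightarrow> g = h \<or> left_less g h"

definition signed_orbital_le :: "signed_orbital \<Rightarrow> signed_orbital \<Rightarrow> bool" where
  "signed_orbital_le p q \<longleftrightarrow>
     fst p \<subset> fst q \<or> (fst p = fst q \<and> left_le (snd p) (snd q))"

definition tower :: "(real \<Rightarrow> real) set \<Rightarrow> signed_orbital set \<Rightarrow> bool" where
  "tower G T \<longleftrightarrow>
     T \<subseteq> signed_orbitals G \<and>
     Complete_Partial_Order.chain signed_orbital_le T \<and>
     (\<forall>A\<in>fst ` T. \<exists>!g. (A, g) \<in> T)"

text \<open>The height of a tower is its cardinality; \<^const>\<open>card\<close> is 0 on infinite sets.\<close>

definition height_at_least :: "signed_orbital set \<Rightarrow> nat \<Rightarrow> bool" where
  "height_at_least T n \<longleftrightarrow> infinite T \<or> n \<le> card T"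

end

theory Submission
  imports Defs
begin

text \<open>
  A finite tower is the same thing as a finite chain of orbitals of elements, and both directions
  compare the chains of a group with those of its derived subgroup.

  If all elements of a group with orbital \<open>(p, q)\<close> are the identity near \<open>p\<close> and \<open>q\<close>, then conjugation
  can push a support off itself, which shows that the derived subgroup again has orbital \<open>(p, q)\<close>;
  such a group is not solvable. Piecewise linearity makes commutators trivial near common fixed
  points, and it follows that a solvable group with orbital \<open>(p, q)\<close> is never generated by elements
  that have fixed points in \<open>(p, q)\<close>.

  Let \<open>A \<subset> B\<close> be orbitals of elements \<open>g\<close> and \<open>h\<close> of a solvable group. The last fact, applied to
  \<open>g\<close> and \<open>h\<close>, and then to the conjugates of \<open>g\<close>, forces \<open>g\<close> to be the identity near the ends of
  \<open>B\<close>. Some conjugate of \<open>g\<close> is then trivial on \<open>A\<close>, so \<open>A\<close> is an orbital of a commutator. Hence a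
  chain loses only its largest member in the derived subgroup, and chains in a solvable group are
  bounded by the derived length. Conversely, an element of the derived subgroup has no orbital with
  an endpoint fixed by the whole group, and an orbital whose endpoint is moved lies strictly inside
  an orbital of another element. Hence every chain in the derived subgroup can be lengthened in the group.
\<close>

section \<open>The group of piecewise linear homeomorphisms\<close>

text \<open>The exceptional points of the composite lie in \<open>D\<close>: those of
  \<open>f\<close> together with the preimages under \<open>f\<close> of those of \<open>g\<close>.
  Injectivity of \<open>f\<close> keeps \<open>D\<close> finite, and an interval avoiding
  \<open>D\<close> is mapped by \<open>f\<close> onto one that avoids \<open>C\<close>, so two
  affine pieces compose.\<close>

lemma piecewise_linear_compose:
  assumes f: "piecewise_linear f" "strict_mono_on {0..1} f" "f ` {0..1} = {0..1}"
    and g: "piecewise_linear g"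
  shows "piecewise_linear (\<lambda>x. g (f x))"
proof -
  obtain B C where B: "finite B" "\<And>a b. 0 \<le> a \<Longrightarrow> a < b \<Longrightarrow> b \<le> 1 \<Longrightarrow> {a<..<b} \<inter> B = {} \<Longrightarrow>
         \<exists>m c. \<forall>x\<in>{a..b}. f x = m * x + c"
    and C: "finite C" "\<And>a b. 0 \<le> a \<Longrightarrow> a < b \<Longrightarrow> b \<le> 1 \<Longrightarrow> {a<..<b} \<inter> C = {} \<Longrightarrow>
         \<exists>m c. \<forall>x\<in>{a..b}. g x = m * x + c"
    using f(1) g unfolding piecewise_linear_def by metis
  have inj: "inj_on f {0..1}"
    using f(2) by (rule strict_mono_on_imp_inj_on)
  define D where "D = B \<union> (f -` C \<inter> {0..1})"
  have "finite D"
    unfolding D_def using B(1) finite_vimage_IntI[OF C(1) inj] by blast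
  moreover have "\<exists>m c. \<forall>x\<in>{a..b}. g (f x) = m * x + c"
    if ab: "0 \<le> a" "a < b" "b \<le> 1" "{a<..<b} \<inter> D = {}" for a b
  proof -
    obtain m c where mc: "\<forall>x\<in>{a..b}. f x = m * x + c"
      using B(2)[of a b] ab unfolding D_def by blast
    have mem: "f x \<in> {0..1}" if "x \<in> {0..1}" for x
      using f(3) that by blast
    have le: "f x \<le> f y" if "x \<le> y" "x \<in> {0..1}" "y \<in> {0..1}" for x y
      using f(2) that by (metis less_eq_real_def strict_mono_onD)
    have "{f a<..<f b} \<inter> C = {}"
    proof (rule ccontr)
      assume "{f a<..<f b} \<inter> C \<noteq> {}"
      then obtain y where y: "f a < y" "y < f b" "y \<in> C" by auto
      then have "y \<in> {0..1}" using mem[of a] mem[of b] ab by auto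
      then obtain x where x: "x \<in> {0..1}" "y = f x" using f(3) by (metis imageE)
      then have "a < x" "x < b" using y le[of x a] le[of b x] ab by force+
      then show False using ab(4) x y unfolding D_def by auto
    qed
    moreover have "f a < f b" using f(2) ab by (simp add: strict_mono_onD)
    ultimately obtain m' c' where m'c': "\<forall>x\<in>{f a..f b}. g x = m' * x + c'"
      using C(2)[of "f a" "f b"] mem[of a] mem[of b] ab by auto
    have "g (f x) = (m' * m) * x + (m' * c + c')" if "x \<in> {a..b}" for x
    proof -
      have "f x \<in> {f a..f b}" using le[of a x] le[of x b] that ab by auto
      then have "g (f x) = m' * f x + c'" using m'c' by blast
      then show ?thesis using mc that by (simp add: algebra_simps)
    qed
    then show ?thesis by blast
  qed
  ultimately show ?thesis unfolding piecewise_linear_def by (intro exI[of _ D]) blast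
qed

text \<open>The images under \<open>f\<close> of its exceptional points serve for \<open>g\<close>.
  Between them \<open>f\<close> is affine, and its slope is nonzero because it takes the distinct
  values \<open>a\<close> and \<open>b\<close>, so the affine formula can be inverted.\<close>

lemma piecewise_linear_inverse:
  assumes f: "piecewise_linear f" "strict_mono_on {0..1} f"
    and g: "\<And>y. y \<in> {0..1} \<Longrightarrow> g y \<in> {0..1}" "\<And>y. y \<in> {0..1} \<Longrightarrow> f (g y) = y"
  shows "piecewise_linear g"
proof -
  obtain B where B: "finite B" "\<And>a b. 0 \<le> a \<Longrightarrow> a < b \<Longrightarrow> b \<le> 1 \<Longrightarrow> {a<..<b} \<inter> B = {} \<Longrightarrow>
         \<exists>m c. \<forall>x\<in>{a..b}. f x = m * x + c"
    using f(1) unfolding piecewise_linear_def by metis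
  have less: "f x < f y \<longleftrightarrow> x < y" if "x \<in> {0..1}" "y \<in> {0..1}" for x y
    using f(2) that by (simp add: strict_mono_on_less)
  have gless: "g x < g y \<longleftrightarrow> x < y" if "x \<in> {0..1}" "y \<in> {0..1}" for x y
    using less[of "g x" "g y"] g that by simp
  have "\<exists>m c. \<forall>y\<in>{a..b}. g y = m * y + c"
    if ab: "0 \<le> a" "a < b" "b \<le> 1" "{a<..<b} \<inter> f ` (B \<inter> {0..1}) = {}" for a b
  proof -
    have in01: "a \<in> {0..1}" "b \<in> {0..1}" using ab by auto
    have "g a < g b" using gless in01 ab by blast
    moreover have "{g a<..<g b} \<inter> B = {}"
    proof (rule ccontr)
      assume "{g a<..<g b} \<inter> B \<noteq> {}"
      then obtain x where x: "g a < x" "x < g b" "x \<in> B" by auto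
      then have "x \<in> {0..1}" using g(1) in01 by (meson atLeastAtMost_iff less_le_trans less_imp_le order_trans)
      moreover from this have "a < f x" "f x < b"
        using x less[of "g a" x] less[of x "g b"] g in01 by auto
      ultimately show False using ab(4) x by auto
    qed
    ultimately obtain m c where mc: "\<forall>x\<in>{g a..g b}. f x = m * x + c"
      using B(2)[of "g a" "g b"] g(1) in01 by auto
    then have "m * g a + c = a" "m * g b + c = b"
      using g(2) in01 \<open>g a < g b\<close> by (metis atLeastAtMost_iff less_imp_le order_refl)+
    then have m: "m \<noteq> 0" using ab by auto
    have "g y = (1/m) * y + (- c/m)" if "y \<in> {a..b}" for y
    proof -
      have y: "y \<in> {0..1}" using that ab by auto
      have "g y \<in> {g a..g b}"
        using gless[of y a] gless[of b y] in01 y that by fastforce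
      then have "f (g y) = m * g y + c" using mc by blast
      then have "y = m * g y + c" using g(2)[OF y] by simp
      then show ?thesis using m by (simp add: field_simps)
    qed
    then show ?thesis by blast
  qed
  then show ?thesis
    unfolding piecewise_linear_def using B(1) by (intro exI[of _ "f ` (B \<inter> {0..1})"]) blast
qed

section \<open>Membership, products and inverses\<close>

lemma PLo_carrierI:
  assumes "f \<in> extensional {0..1}" "f ` {0..1} = {0..1}" "strict_mono_on {0..1} f"
    "continuous_on {0..1} f" "piecewise_linear f"
  shows "f \<in> carrier PLo"
proof -
  have "inj_on f {0..1}"
    using assms(3) by (rule strict_mono_on_imp_inj_on)
  then obtain f' where "homeomorphism {0..1} {0..1} f f'"
    using homeomorphism_compact[OF compact_Icc assms(4,2)] by blast
  then show ?thesis using assms unfolding PLo_def by auto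
qed

lemma PLo_carrierD:
  assumes "f \<in> carrier PLo"
  shows "f \<in> extensional {0..1}" "f ` {0..1} = {0..1}" "strict_mono_on {0..1} f"
    "continuous_on {0..1} f" "piecewise_linear f"
  using assms by (auto simp: PLo_def homeomorphism_def)

lemma PLo_mem: "f \<in> carrier PLo \<Longrightarrow> x \<in> {0..1} \<Longrightarrow> f x \<in> {0..1}"
  using PLo_carrierD(2) by blast

lemma PLo_less_iff: "f \<in> carrier PLo \<Longrightarrow> x \<in> {0..1} \<Longrightarrow> y \<in> {0..1} \<Longrightarrow> f x < f y \<longleftrightarrow> x < y"
  using strict_mono_on_less[OF PLo_carrierD(3)] by blast

lemma PLo_le_iff: "f \<in> carrier PLo \<Longrightarrow> x \<in> {0..1} \<Longrightarrow> y \<in> {0..1} \<Longrightarrow> f x \<le> f y \<longleftrightarrow> x \<le> y"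
  using PLo_less_iff[of f y x] by auto

lemma PLo_mult_apply: "x \<in> {0..1} \<Longrightarrow> (f \<otimes>\<^bsub>PLo\<^esub> g) x = g (f x)"
  by (simp add: PLo_def compose_def)

lemma PLo_one_apply: "x \<in> {0..1} \<Longrightarrow> \<one>\<^bsub>PLo\<^esub> x = x"
  by (simp add: PLo_def)

lemma PLo_eqI:
  assumes "f \<in> carrier PLo" "g \<in> carrier PLo" "\<And>x. x \<in> {0..1} \<Longrightarrow> f x = g x"
  shows "f = g"
  using PLo_carrierD(1)[OF assms(1)] PLo_carrierD(1)[OF assms(2)] assms(3)
  by (rule extensionalityI)

lemma PLo_one_closed: "\<one>\<^bsub>PLo\<^esub> \<in> carrier PLo"
proof (rule PLo_carrierI)
  show "piecewise_linear \<one>\<^bsub>PLo\<^esub>"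
    unfolding piecewise_linear_def
  proof (intro exI[of _ "{}"] conjI allI impI)
    fix a b :: real assume "0 \<le> a \<and> a < b \<and> b \<le> 1 \<and> {a<..<b} \<inter> {} = {}"
    then show "\<exists>m c. \<forall>x\<in>{a..b}. \<one>\<^bsub>PLo\<^esub> x = m * x + c"
      by (intro exI[of _ 1] exI[of _ 0]) (auto simp: PLo_one_apply)
  qed auto
  show "continuous_on {0..1} \<one>\<^bsub>PLo\<^esub>"
    by (rule continuous_on_eq[OF continuous_on_id]) (simp add: PLo_one_apply)
qed (auto simp: PLo_def strict_mono_on_def)

lemma PLo_mult_closed:
  assumes f: "f \<in> carrier PLo" and g: "g \<in> carrier PLo"
  shows "f \<otimes>\<^bsub>PLo\<^esub> g \<in> carrier PLo"
proof (rule PLo_carrierI)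
  note F = PLo_carrierD[OF f] and G = PLo_carrierD[OF g]
  have eq: "(f \<otimes>\<^bsub>PLo\<^esub> g) x = g (f x)" if "x \<in> {0..1}" for x
    using that by (rule PLo_mult_apply)
  show "f \<otimes>\<^bsub>PLo\<^esub> g \<in> extensional {0..1}" by (simp add: PLo_def)
  have "(f \<otimes>\<^bsub>PLo\<^esub> g) ` {0..1} = g ` f ` {0..1}"
    unfolding image_image by (rule image_cong[OF refl eq])
  then show "(f \<otimes>\<^bsub>PLo\<^esub> g) ` {0..1} = {0..1}" using F G by simp
  show "strict_mono_on {0..1} (f \<otimes>\<^bsub>PLo\<^esub> g)"
    by (intro strict_mono_onI) (use f g in \<open>simp add: eq PLo_less_iff PLo_mem del: atLeastAtMost_iff\<close>)
  have "continuous_on {0..1} (\<lambda>x. g (f x))"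
    by (rule continuous_on_compose2[OF G(4) F(4)]) (use F in auto)
  then show "continuous_on {0..1} (f \<otimes>\<^bsub>PLo\<^esub> g)"
    by (rule continuous_on_eq) (simp add: eq)
  obtain B where B: "finite B" "\<And>a b. 0 \<le> a \<Longrightarrow> a < b \<Longrightarrow> b \<le> 1 \<Longrightarrow> {a<..<b} \<inter> B = {} \<Longrightarrow>
         \<exists>m c. \<forall>x\<in>{a..b}. g (f x) = m * x + c"
    using piecewise_linear_compose[OF F(5,3,2) G(5)] unfolding piecewise_linear_def by metis
  show "piecewise_linear (f \<otimes>\<^bsub>PLo\<^esub> g)"
    unfolding piecewise_linear_def
  proof (intro exI[of _ B] conjI allI impI)
    fix a b :: real assume ab: "0 \<le> a \<and> a < b \<and> b \<le> 1 \<and> {a<..<b} \<inter> B = {}"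
    then obtain m c where "\<forall>x\<in>{a..b}. g (f x) = m * x + c" using B(2)[of a b] by blast
    then show "\<exists>m c. \<forall>x\<in>{a..b}. (f \<otimes>\<^bsub>PLo\<^esub> g) x = m * x + c"
      using ab by (intro exI[of _ m] exI[of _ c]) (auto simp: eq)
  qed (rule B)
qed

lemma PLo_inverse_exists:
  assumes f: "f \<in> carrier PLo"
  shows "\<exists>g\<in>carrier PLo. g \<otimes>\<^bsub>PLo\<^esub> f = \<one>\<^bsub>PLo\<^esub>"
proof -
  note F = PLo_carrierD[OF f]
  define g where "g = restrict (inv_into {0..1} f) {0..1}"
  have fg: "f (g y) = y" "g y \<in> {0..1}" if "y \<in> {0..1}" for y
    using that F(2) unfolding g_def by (simp_all add: f_inv_into_f inv_into_into del: atLeastAtMost_iff)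
  have inj: "inj_on f {0..1}"
    using F(3) by (rule strict_mono_on_imp_inj_on)
  have gf: "g (f x) = x" if "x \<in> {0..1}" for x
    using that PLo_mem[OF f that] inj unfolding g_def by (simp del: atLeastAtMost_iff)
  have "continuous_on (f ` {0..1}) g"
    by (rule continuous_on_inv[OF F(4) compact_Icc]) (use gf in blast)
  then have cont: "continuous_on {0..1} g" using F(2) by simp
  have "g \<in> carrier PLo"
  proof (rule PLo_carrierI[OF _ _ _ cont])
    show "g ` {0..1} = {0..1}"
      using fg gf PLo_mem[OF f] by (force simp del: atLeastAtMost_iff)
    show "strict_mono_on {0..1} g"
      by (intro strict_mono_onI) (metis PLo_less_iff[OF f] fg)
    show "piecewise_linear g"
      using piecewise_linear_inverse[OF F(5,3)] fg by blast
  qed (simp add: g_def)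
  moreover have "g \<otimes>\<^bsub>PLo\<^esub> f = \<one>\<^bsub>PLo\<^esub>"
    by (rule PLo_eqI[OF PLo_mult_closed[OF calculation f] PLo_one_closed])
      (simp add: PLo_mult_apply PLo_one_apply fg del: atLeastAtMost_iff)
  ultimately show ?thesis by blast
qed

lemma group_PLo: "group PLo"
proof (rule groupI)
  fix f g h assume fgh: "f \<in> carrier PLo" "g \<in> carrier PLo" "h \<in> carrier PLo"
  show "f \<otimes>\<^bsub>PLo\<^esub> g \<otimes>\<^bsub>PLo\<^esub> h = f \<otimes>\<^bsub>PLo\<^esub> (g \<otimes>\<^bsub>PLo\<^esub> h)"
  proof (rule PLo_eqI)
    fix x :: real assume x: "x \<in> {0..1}"
    show "(f \<otimes>\<^bsub>PLo\<^esub> g \<otimes>\<^bsub>PLo\<^esub> h) x = (f \<otimes>\<^bsub>PLo\<^esub> (g \<otimes>\<^bsub>PLo\<^esub> h)) x"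
      by (simp only: PLo_mult_apply x PLo_mem[OF fgh(1) x])
  qed (simp_all only: PLo_mult_closed fgh)
next
  fix f assume f: "f \<in> carrier PLo"
  show "\<one>\<^bsub>PLo\<^esub> \<otimes>\<^bsub>PLo\<^esub> f = f"
    by (rule PLo_eqI) (simp_all only: PLo_mult_apply PLo_one_apply PLo_mult_closed PLo_one_closed f)
qed (blast intro: PLo_mult_closed PLo_one_closed PLo_inverse_exists)+

interpretation PLo: group PLo
  by (rule group_PLo)

lemma PLo_inv_apply:
  assumes f: "f \<in> carrier PLo" and x: "x \<in> {0..1}"
  shows "(inv\<^bsub>PLo\<^esub> f) (f x) = x" "f ((inv\<^bsub>PLo\<^esub> f) x) = x"
  using PLo_mult_apply[OF x, of f "inv\<^bsub>PLo\<^esub> f"] PLo_mult_apply[OF x, of "inv\<^bsub>PLo\<^esub> f" f]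
    PLo_one_apply[OF x] f by simp_all

lemma PLo_inv_fix_iff:
  assumes "f \<in> carrier PLo" "x \<in> {0..1}"
  shows "(inv\<^bsub>PLo\<^esub> f) x = x \<longleftrightarrow> f x = x"
  by (metis PLo_inv_apply assms)

lemma generate_fix:
  assumes S: "S \<subseteq> carrier PLo" and fix_S: "\<And>s. s \<in> S \<Longrightarrow> s x = x" and x: "x \<in> {0..1}"
    and k: "k \<in> generate PLo S"
  shows "k x = x"
  using k
proof (induction rule: generate.induct)
  case one
  show ?case by (rule PLo_one_apply[OF x])
next
  case (incl h)
  then show ?case by (rule fix_S)
next
  case (inv h)
  then show ?case using PLo_inv_fix_iff[OF _ x] S fix_S by blast
next
  case (eng g h)
  then show ?case by (simp only: PLo_mult_apply[OF x])
qed

section \<open>Orbitals as intervals\<close>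

abbreviation orbit_set :: "(real \<Rightarrow> real) set \<Rightarrow> real \<Rightarrow> real set" where
  "orbit_set K x \<equiv> (\<lambda>k. k x) ` K"

lemma orbit_set_bounds:
  assumes K: "subgroup K PLo" and x: "x \<in> {0..1}"
  shows "x \<in> orbit_set K x" "orbit_set K x \<subseteq> {0..1}"
    "bdd_above (orbit_set K x)" "bdd_below (orbit_set K x)"
proof -
  have "\<one>\<^bsub>PLo\<^esub> \<in> K" by (rule subgroup.one_closed[OF K])
  then show "x \<in> orbit_set K x" using PLo_one_apply[OF x] by (metis image_eqI)
  show sub: "orbit_set K x \<subseteq> {0..1}"
    using PLo_mem[OF subgroup.mem_carrier[OF K] x] by blast
  show "bdd_above (orbit_set K x)" "bdd_below (orbit_set K x)"
    by (rule bdd_above_mono[OF _ sub] bdd_below_mono[OF _ sub]; simp)+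
qed

text \<open>Each \<open>l\<close> in \<open>K\<close> maps the orbit into itself, so pulling the
  upper bound \<open>s\<close> back by \<open>l\<close> gives another upper bound; hence
  \<open>l s <= s\<close>. The same inequality for the inverse of \<open>k\<close> yields
  equality.\<close>

lemma Sup_orbit_fixed:
  assumes K: "subgroup K PLo" and x: "x \<in> {0..1}" and k: "k \<in> K"
  shows "Sup (orbit_set K x) \<in> {0..1}" "k (Sup (orbit_set K x)) = Sup (orbit_set K x)"
proof -
  define s where "s = Sup (orbit_set K x)"
  note O = orbit_set_bounds[OF K x]
  have s_ge: "l x \<le> s" if "l \<in> K" for l
    unfolding s_def using that O(3) by (intro cSup_upper) auto
  have s_le: "s \<le> y" if "\<And>l. l \<in> K \<Longrightarrow> l x \<le> y" for y
    unfolding s_def using that O(1) by (intro cSup_least) auto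
  have s01: "s \<in> {0..1}"
    using s_ge[OF subgroup.one_closed[OF K]] PLo_one_apply[OF x] x s_le[of 1]
      PLo_mem[OF subgroup.mem_carrier[OF K] x] by force
  have le: "l s \<le> s" if l: "l \<in> K" for l
  proof -
    have lc: "l \<in> carrier PLo" "inv\<^bsub>PLo\<^esub> l \<in> K"
      using subgroup.mem_carrier[OF K] l subgroup.m_inv_closed[OF K l] by auto
    then have ilc: "inv\<^bsub>PLo\<^esub> l \<in> carrier PLo" using subgroup.mem_carrier[OF K] by blast
    have "s \<le> (inv\<^bsub>PLo\<^esub> l) s"
    proof (rule s_le)
      fix m assume m: "m \<in> K"
      have mx: "m x \<in> {0..1}" using PLo_mem[OF subgroup.mem_carrier[OF K m] x] .
      have "l (m x) \<le> s"
        using s_ge[OF subgroup.m_closed[OF K m l]] PLo_mult_apply[OF x] by simp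
      then have "(inv\<^bsub>PLo\<^esub> l) (l (m x)) \<le> (inv\<^bsub>PLo\<^esub> l) s"
        using PLo_le_iff[OF ilc PLo_mem[OF lc(1) mx] s01] by blast
      then show "m x \<le> (inv\<^bsub>PLo\<^esub> l) s" using PLo_inv_apply(1)[OF lc(1) mx] by simp
    qed
    then have "l s \<le> l ((inv\<^bsub>PLo\<^esub> l) s)"
      using PLo_le_iff[OF lc(1) s01 PLo_mem[OF ilc s01]] by blast
    then show "l s \<le> s"
      using PLo_inv_apply(2)[OF lc(1) s01] by simp
  qed
  have kc: "k \<in> carrier PLo" "inv\<^bsub>PLo\<^esub> k \<in> K"
    using subgroup.mem_carrier[OF K] k subgroup.m_inv_closed[OF K k] by auto
  then have ikc: "inv\<^bsub>PLo\<^esub> k \<in> carrier PLo" using subgroup.mem_carrier[OF K] by blast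
  have "k ((inv\<^bsub>PLo\<^esub> k) s) \<le> k s"
    using PLo_le_iff[OF kc(1) PLo_mem[OF ikc s01] s01] le[OF kc(2)] by blast
  then have "s \<le> k s" using PLo_inv_apply(2)[OF kc(1) s01] by simp
  then show "Sup (orbit_set K x) \<in> {0..1}" "k (Sup (orbit_set K x)) = Sup (orbit_set K x)"
    using s01 le[OF k] unfolding s_def by auto
qed

text \<open>Mirror image of the argument for the supremum.\<close>

lemma Inf_orbit_fixed:
  assumes K: "subgroup K PLo" and x: "x \<in> {0..1}" and k: "k \<in> K"
  shows "Inf (orbit_set K x) \<in> {0..1}" "k (Inf (orbit_set K x)) = Inf (orbit_set K x)"
proof -
  define s where "s = Inf (orbit_set K x)"
  note O = orbit_set_bounds[OF K x]
  have s_le: "s \<le> l x" if "l \<in> K" for l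
    unfolding s_def using that O(4) by (intro cInf_lower) auto
  have s_ge: "y \<le> s" if "\<And>l. l \<in> K \<Longrightarrow> y \<le> l x" for y
    unfolding s_def using that O(1) by (intro cInf_greatest) auto
  have s01: "s \<in> {0..1}"
    using s_le[OF subgroup.one_closed[OF K]] PLo_one_apply[OF x] x s_ge[of 0]
      PLo_mem[OF subgroup.mem_carrier[OF K] x] by force
  have ge: "s \<le> l s" if l: "l \<in> K" for l
  proof -
    have lc: "l \<in> carrier PLo" "inv\<^bsub>PLo\<^esub> l \<in> K"
      using subgroup.mem_carrier[OF K] l subgroup.m_inv_closed[OF K l] by auto
    then have ilc: "inv\<^bsub>PLo\<^esub> l \<in> carrier PLo" using subgroup.mem_carrier[OF K] by blast
    have "(inv\<^bsub>PLo\<^esub> l) s \<le> s"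
    proof (rule s_ge)
      fix m assume m: "m \<in> K"
      have mx: "m x \<in> {0..1}" using PLo_mem[OF subgroup.mem_carrier[OF K m] x] .
      have "s \<le> l (m x)"
        using s_le[OF subgroup.m_closed[OF K m l]] PLo_mult_apply[OF x] by simp
      then have "(inv\<^bsub>PLo\<^esub> l) s \<le> (inv\<^bsub>PLo\<^esub> l) (l (m x))"
        using PLo_le_iff[OF ilc s01 PLo_mem[OF lc(1) mx]] by blast
      then show "(inv\<^bsub>PLo\<^esub> l) s \<le> m x" using PLo_inv_apply(1)[OF lc(1) mx] by simp
    qed
    then have "l ((inv\<^bsub>PLo\<^esub> l) s) \<le> l s"
      using PLo_le_iff[OF lc(1) PLo_mem[OF ilc s01] s01] by blast
    then show "s \<le> l s"
      using PLo_inv_apply(2)[OF lc(1) s01] by simp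
  qed
  have kc: "k \<in> carrier PLo" "inv\<^bsub>PLo\<^esub> k \<in> K"
    using subgroup.mem_carrier[OF K] k subgroup.m_inv_closed[OF K k] by auto
  then have ikc: "inv\<^bsub>PLo\<^esub> k \<in> carrier PLo" using subgroup.mem_carrier[OF K] by blast
  have "k s \<le> k ((inv\<^bsub>PLo\<^esub> k) s)"
    using PLo_le_iff[OF kc(1) s01 PLo_mem[OF ikc s01]] ge[OF kc(2)] by blast
  then have "k s \<le> s" using PLo_inv_apply(2)[OF kc(1) s01] by simp
  then show "Inf (orbit_set K x) \<in> {0..1}" "k (Inf (orbit_set K x)) = Inf (orbit_set K x)"
    using s01 ge[OF k] unfolding s_def by auto
qed

text \<open>An orbital in terms of its endpoints, as a component of the support. This form replaces
  convex hulls of orbits by fixed points; \<open>orbitals_eq\<close> shows that the two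
  agree.\<close>

definition orbital_interval :: "(real \<Rightarrow> real) set \<Rightarrow> real \<Rightarrow> real \<Rightarrow> bool" where
  "orbital_interval K p q \<longleftrightarrow> subgroup K PLo \<and> 0 \<le> p \<and> p < q \<and> q \<le> 1 \<and>
     (\<forall>k\<in>K. k p = p \<and> k q = q) \<and> (\<forall>x\<in>{p<..<q}. \<exists>k\<in>K. k x \<noteq> x)"

lemma orbital_intervalD:
  assumes "orbital_interval K p q"
  shows "subgroup K PLo" "0 \<le> p" "p < q" "q \<le> 1" "p \<in> {0..1}" "q \<in> {0..1}"
    "\<And>k. k \<in> K \<Longrightarrow> k p = p" "\<And>k. k \<in> K \<Longrightarrow> k q = q"
    "\<And>k. k \<in> K \<Longrightarrow> k \<in> carrier PLo"
    "\<And>x. x \<in> {p<..<q} \<Longrightarrow> \<exists>k\<in>K. k x \<noteq> x" "\<And>x. x \<in> {p<..<q} \<Longrightarrow> x \<in> {0..1}"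
  using assms subgroup.mem_carrier unfolding orbital_interval_def by fastforce+

lemma orbital_interval_mem:
  assumes K: "orbital_interval K p q" and k: "k \<in> K" and x: "x \<in> {p<..<q}"
  shows "k x \<in> {p<..<q}"
proof -
  note D = orbital_intervalD[OF K]
  have "k p < k x" "k x < k q"
    using PLo_less_iff[OF D(9)[OF k]] D(5,6) D(11)[OF x] x by auto
  then show ?thesis using D(7,8)[OF k] by simp
qed

text \<open>The supremum of the orbit of \<open>x\<close> is a common fixed point at or above
  \<open>x\<close>. The interior has no common fixed point, so this supremum is at least
  \<open>q\<close>, and the orbit passes every \<open>z < q\<close>.\<close>

lemma orbital_interval_push_right:
  assumes K: "orbital_interval K p q" and x: "x \<in> {p<..<q}" and z: "z < q"
  obtains k where "k \<in> K" "z < k x"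
proof -
  note D = orbital_intervalD[OF K]
  define s where "s = Sup (orbit_set K x)"
  have fixed: "k s = s" if "k \<in> K" for k
    unfolding s_def using Sup_orbit_fixed(2)[OF D(1) D(11)[OF x] that] .
  have "x \<le> s"
    unfolding s_def using orbit_set_bounds[OF D(1) D(11)[OF x]] by (intro cSup_upper)
  then have "\<not> s < q" using D(10)[of s] fixed x by auto
  then have "z < s" using z by simp
  then show thesis
    using orbit_set_bounds[OF D(1) D(11)[OF x]] that less_cSup_iff[of "orbit_set K x" z]
    unfolding s_def by blast
qed

lemma orbital_interval_push_left:
  assumes K: "orbital_interval K p q" and x: "x \<in> {p<..<q}" and z: "p < z"
  obtains k where "k \<in> K" "k x < z"
proof -
  note D = orbital_intervalD[OF K]
  define s where "s = Inf (orbit_set K x)"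
  have fixed: "k s = s" if "k \<in> K" for k
    unfolding s_def using Inf_orbit_fixed(2)[OF D(1) D(11)[OF x] that] .
  have "s \<le> x"
    unfolding s_def using orbit_set_bounds[OF D(1) D(11)[OF x]] by (intro cInf_lower)
  then have "\<not> p < s" using D(10)[of s] fixed x by auto
  then have "s < z" using z by simp
  then show thesis
    using orbit_set_bounds[OF D(1) D(11)[OF x]] that cInf_less_iff[of "orbit_set K x" z]
    unfolding s_def by blast
qed

text \<open>The orbit stays inside the interval and comes arbitrarily close to both ends, so
  segments between orbit points exhaust the interval.\<close>

lemma orbital_interval_hull:
  assumes K: "orbital_interval K p q" and x: "x \<in> {p<..<q}"
  shows "convex hull (orbit_set K x) = {p<..<q}"
proof
  have "orbit_set K x \<subseteq> {p<..<q}"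
    using orbital_interval_mem[OF K _ x] by blast
  then show "convex hull (orbit_set K x) \<subseteq> {p<..<q}"
    by (rule hull_minimal) simp
  show "{p<..<q} \<subseteq> convex hull (orbit_set K x)"
  proof
    fix z assume z: "z \<in> {p<..<q}"
    obtain k l where kl: "k \<in> K" "z < k x" "l \<in> K" "l x < z"
      using orbital_interval_push_left[OF K x, of z] orbital_interval_push_right[OF K x, of z] z
      by (metis greaterThanLessThan_iff)
    then have "z \<in> closed_segment (l x) (k x)"
      by (auto simp: closed_segment_eq_real_ivl)
    moreover have "closed_segment (l x) (k x) \<subseteq> convex hull (orbit_set K x)"
      using kl by (intro closed_segment_subset convex_convex_hull hull_inc) auto
    ultimately show "z \<in> convex hull (orbit_set K x)" by blast
  qed
qed

text \<open>The endpoints are the infimum and the supremum of the orbit of \<open>x\<close>. A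
  common fixed point strictly between them would have orbit points on both sides, but a monotone map
  fixing it cannot carry \<open>x\<close> across.\<close>

lemma orbital_interval_exists:
  assumes K: "subgroup K PLo" and x: "x \<in> {0..1}" and k: "k \<in> K" "k x \<noteq> x"
  obtains p q where "orbital_interval K p q" "x \<in> {p<..<q}"
proof -
  define p where "p = Inf (orbit_set K x)"
  define q where "q = Sup (orbit_set K x)"
  note O = orbit_set_bounds[OF K x]
  note P = Inf_orbit_fixed[OF K x, folded p_def]
  note Q = Sup_orbit_fixed[OF K x, folded q_def]
  have "p \<le> x" "x \<le> q"
    unfolding p_def q_def using O by (auto intro: cInf_lower cSup_upper)
  then have pxq: "x \<in> {p<..<q}"
    using P(2)[OF k(1)] Q(2)[OF k(1)] k(2) by (cases "x = p"; cases "x = q") auto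
  have free: "\<exists>l\<in>K. l y \<noteq> y" if y: "y \<in> {p<..<q}" for y
  proof (rule ccontr)
    assume "\<not> ?thesis"
    then have fixed: "l y = y" if "l \<in> K" for l using that by blast
    have y01: "y \<in> {0..1}" using y P(1)[OF k(1)] Q(1)[OF k(1)] by auto
    have less: "l x < y \<longleftrightarrow> x < y" "y < l x \<longleftrightarrow> y < x" if "l \<in> K" for l
      using PLo_less_iff[OF subgroup.mem_carrier[OF K that]] x y01 fixed[OF that] by metis+
    have ne: "orbit_set K x \<noteq> {}" using O(1) by blast
    obtain l where "l \<in> K" "l x < y"
      using cInf_less_iff[OF ne O(4), of y] y unfolding p_def by auto
    moreover obtain m where "m \<in> K" "y < m x"
      using less_cSup_iff[OF ne O(3), of y] y unfolding q_def by auto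
    ultimately show False using less by force
  qed
  have "orbital_interval K p q"
    unfolding orbital_interval_def
    using K P Q k(1) pxq free by auto
  then show thesis using that pxq by blast
qed

lemma orbitals_eq:
  assumes K: "subgroup K PLo"
  shows "orbitals K = {A. \<exists>p q. A = {p<..<q} \<and> orbital_interval K p q}"
proof -
  have orb: "orbit (PLo\<lparr>carrier := K\<rparr>) (\<lambda>f. f) x = orbit_set K x" for x
    unfolding orbit_def by auto
  show ?thesis
  proof (intro equalityI subsetI)
    fix A assume "A \<in> orbitals K"
    then obtain x y z where A: "x \<in> {0..1}" "A = convex hull (orbit_set K x)" "y \<in> A" "z \<in> A" "y \<noteq> z"
      unfolding orbitals_def orb by blast
    have "\<exists>k\<in>K. k x \<noteq> x"
    proof (rule ccontr)
      assume "\<not> ?thesis"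
      then have "orbit_set K x \<subseteq> {x}" by auto
      then have "A \<subseteq> {x}" unfolding A(2) by (rule hull_minimal) simp
      then show False using A by blast
    qed
    then obtain p q where "orbital_interval K p q" "x \<in> {p<..<q}"
      using orbital_interval_exists[OF K A(1)] by blast
    then show "A \<in> {A. \<exists>p q. A = {p<..<q} \<and> orbital_interval K p q}"
      using A(2) orbital_interval_hull by auto
  next
    fix A assume "A \<in> {A. \<exists>p q. A = {p<..<q} \<and> orbital_interval K p q}"
    then obtain p q where A: "A = {p<..<q}" and pq: "orbital_interval K p q" by blast
    note D = orbital_intervalD[OF pq]
    define x y where "x = (p + q) / 2" and "y = (p + x) / 2"
    have x: "x \<in> {p<..<q}" and y: "y \<in> {p<..<q}" "x \<noteq> y" using D(3) by (auto simp: x_def y_def field_simps)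
    have "A = convex hull (orbit_set K x)"
      using orbital_interval_hull[OF pq x] A by simp
    moreover have "x \<in> {0..1}" using D(11)[OF x] .
    ultimately show "A \<in> orbitals K"
      unfolding orbitals_def orb using x y A by blast
  qed
qed

section \<open>Orbitals of a single element\<close>

lemma orbital_interval_cyclic_iff:
  assumes g: "g \<in> carrier PLo"
  shows "orbital_interval (generate PLo {g}) a b \<longleftrightarrow>
    0 \<le> a \<and> a < b \<and> b \<le> 1 \<and> g a = a \<and> g b = b \<and> (\<forall>x\<in>{a<..<b}. g x \<noteq> x)"
proof -
  have G: "subgroup (generate PLo {g}) PLo"
    using PLo.generate_is_subgroup g by blast
  have gg: "g \<in> generate PLo {g}" by (simp add: generate.incl)
  \<comment> \<open>A cyclic group has the same common fixed points as its generator, so its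
    orbitals can be read off from \<open>g\<close> alone.\<close>
  have fix_iff: "(\<forall>k\<in>generate PLo {g}. k x = x) \<longleftrightarrow> g x = x" if "x \<in> {0..1}" for x
    using generate_fix[of "{g}" x] g gg that by blast
  show ?thesis
  proof
    assume A: "orbital_interval (generate PLo {g}) a b"
    note D = orbital_intervalD[OF A]
    have "g x \<noteq> x" if "x \<in> {a<..<b}" for x
      using fix_iff[OF D(11)[OF that]] D(10)[OF that] by blast
    then show "0 \<le> a \<and> a < b \<and> b \<le> 1 \<and> g a = a \<and> g b = b \<and> (\<forall>x\<in>{a<..<b}. g x \<noteq> x)"
      using D gg by blast
  next
    assume A: "0 \<le> a \<and> a < b \<and> b \<le> 1 \<and> g a = a \<and> g b = b \<and> (\<forall>x\<in>{a<..<b}. g x \<noteq> x)"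
    moreover have "k a = a \<and> k b = b" if "k \<in> generate PLo {g}" for k
      using fix_iff[of a] fix_iff[of b] A that by auto
    ultimately show "orbital_interval (generate PLo {g}) a b"
      unfolding orbital_interval_def using G gg by blast
  qed
qed

lemma elem_orbitals_iff:
  assumes "g \<in> carrier PLo"
  shows "A \<in> elem_orbitals g \<longleftrightarrow> (\<exists>a b. A = {a<..<b} \<and>
    0 \<le> a \<and> a < b \<and> b \<le> 1 \<and> g a = a \<and> g b = b \<and> (\<forall>x\<in>{a<..<b}. g x \<noteq> x))"
  unfolding elem_orbitals_def
  using orbitals_eq[OF PLo.generate_is_subgroup, of "{g}"] orbital_interval_cyclic_iff[OF assms] assms
  by auto

section \<open>Germs at fixed points and solvability\<close>

text \<open>\<open>F\<close> describes the punctured one-sided neighbourhoods of \<open>p\<close>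
  that lie in the unit interval. Keeping \<open>F\<close> variable lets one statement about germs
  cover both sides.\<close>

definition one_sided :: "real filter \<Rightarrow> real \<Rightarrow> bool" where
  "one_sided F p \<longleftrightarrow> F = at_right p \<and> 0 \<le> p \<and> p < 1 \<or> F = at_left p \<and> 0 < p \<and> p \<le> 1"

lemma one_sided_mem:
  assumes "one_sided F p"
  shows "p \<in> {0..1}" "\<forall>\<^sub>F x in F. x \<in> {0..1} \<and> x \<noteq> p"
proof -
  show "p \<in> {0..1}" using assms unfolding one_sided_def by auto
  have "\<exists>b>p. \<forall>y>p. y < b \<longrightarrow> y \<in> {0..1} \<and> y \<noteq> p" if "0 \<le> p" "p < 1"
    using that by (intro exI[of _ 1]) auto
  moreover have "\<exists>b<p. \<forall>y>b. y < p \<longrightarrow> y \<in> {0..1} \<and> y \<noteq> p" if "0 < p" "p \<le> 1"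
    using that by (intro exI[of _ 0]) auto
  ultimately show "\<forall>\<^sub>F x in F. x \<in> {0..1} \<and> x \<noteq> p"
    using assms unfolding one_sided_def
    by (auto simp only: eventually_at_right_field eventually_at_left_field)
qed

text \<open>On the chosen side of \<open>p\<close>, \<open>b\<close> is the nearest exceptional
  point of \<open>f\<close>, or the end of the unit interval if there is none. Up to
  \<open>b\<close> the map is a single affine piece.\<close>

lemma one_sided_affine:
  assumes F: "one_sided F p" and f: "f \<in> carrier PLo"
  obtains m where "\<forall>\<^sub>F x in F. f x = f p + m * (x - p)"
proof -
  obtain B where B: "finite B" "\<And>a b. 0 \<le> a \<Longrightarrow> a < b \<Longrightarrow> b \<le> 1 \<Longrightarrow> {a<..<b} \<inter> B = {} \<Longrightarrow>
         \<exists>m c. \<forall>x\<in>{a..b}. f x = m * x + c"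
    using PLo_carrierD(5)[OF f] unfolding piecewise_linear_def by metis
  consider (R) "F = at_right p" "0 \<le> p" "p < 1" | (L) "F = at_left p" "0 < p" "p \<le> 1"
    using F unfolding one_sided_def by blast
  then show thesis
  proof cases
    case R
    define b where "b = Min (insert 1 {x \<in> B. p < x})"
    have fin: "finite (insert 1 {x \<in> B. p < x})" using B(1) by simp
    have b: "p < b" "b \<le> 1" unfolding b_def using fin R(3) by auto
    have "b \<le> y" if "y \<in> B" "p < y" for y
      unfolding b_def using fin that by (intro Min_le) auto
    then have "{p<..<b} \<inter> B = {}" by force
    then obtain m c where mc: "\<forall>x\<in>{p..b}. f x = m * x + c"
      using B(2)[OF R(2) b] by blast
    then have "f p = m * p + c" using b by auto
    then have "\<forall>y>p. y < b \<longrightarrow> f y = f p + m * (y - p)"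
      using mc by (auto simp: algebra_simps)
    then have "\<forall>\<^sub>F x in F. f x = f p + m * (x - p)"
      unfolding R(1) eventually_at_right_field using b by blast
    then show thesis by (rule that)
  next
    case L
    define b where "b = Max (insert 0 {x \<in> B. x < p})"
    have fin: "finite (insert 0 {x \<in> B. x < p})" using B(1) by simp
    have b: "b < p" "0 \<le> b" unfolding b_def using fin L(2) by auto
    have "y \<le> b" if "y \<in> B" "y < p" for y
      unfolding b_def using fin that by (intro Max_ge) auto
    then have "{b<..<p} \<inter> B = {}" by force
    then obtain m c where mc: "\<forall>x\<in>{b..p}. f x = m * x + c"
      using B(2)[OF b(2,1) L(3)] by blast
    then have "f p = m * p + c" using b by auto
    then have "\<forall>y>b. y < p \<longrightarrow> f y = f p + m * (y - p)"
      using mc by (auto simp: algebra_simps)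
    then have "\<forall>\<^sub>F x in F. f x = f p + m * (x - p)"
      unfolding L(1) eventually_at_left_field using b by blast
    then show thesis by (rule that)
  qed
qed

text \<open>A homeomorphism fixing \<open>p\<close> and preserving order carries small one-sided
  neighbourhoods of \<open>p\<close> to such neighbourhoods: the one bounded by \<open>h c\<close>
  is sent into the one bounded by \<open>c\<close>, where \<open>h\<close> is the inverse of
  \<open>g\<close>.\<close>

lemma one_sided_pullback:
  assumes F: "one_sided F p" and g: "g \<in> carrier PLo" "g p = p"
    and P: "\<forall>\<^sub>F x in F. P x"
  shows "\<forall>\<^sub>F x in F. P (g x)"
proof -
  define h where "h = inv\<^bsub>PLo\<^esub> g"
  have h: "h \<in> carrier PLo" unfolding h_def using g by simp
  have p: "p \<in> {0..1}" by (rule one_sided_mem[OF F])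
  have hp: "h p = p" unfolding h_def using PLo_inv_fix_iff[OF g(1) p] g(2) by simp
  have gh: "g (h x) = x" if "x \<in> {0..1}" for x
    unfolding h_def using PLo_inv_apply[OF g(1) that] by simp
  consider (R) "F = at_right p" "0 \<le> p" "p < 1" | (L) "F = at_left p" "0 < p" "p \<le> 1"
    using F unfolding one_sided_def by blast
  then show ?thesis
  proof cases
    case R
    obtain b where b: "p < b" "\<forall>y>p. y < b \<longrightarrow> P y"
      using P unfolding R(1) eventually_at_right_field by blast
    \<comment> \<open>Cutting off at 1 keeps \<open>c\<close> in the domain where \<open>h\<close>
      inverts \<open>g\<close>.\<close>
    define c where "c = min b 1"
    have c: "c \<in> {0..1}" "p < c" "c \<le> b" unfolding c_def using b R by auto
    have hc: "h c \<in> {0..1}" "p < h c"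
      using PLo_mem[OF h c(1)] PLo_less_iff[OF h p c(1)] c(2) hp by auto
    have "P (g x)" if x: "p < x" "x < h c" for x
    proof -
      have "x \<in> {0..1}" using x hc p by auto
      then have "p < g x" "g x < c"
        using PLo_less_iff[OF g(1), of p x] PLo_less_iff[OF g(1), of x "h c"] p hc x g(2) gh[OF c(1)]
        by auto
      then show ?thesis using b(2) c(3) by auto
    qed
    then show ?thesis unfolding R(1) eventually_at_right_field using hc by blast
  next
    case L
    obtain b where b: "b < p" "\<forall>y>b. y < p \<longrightarrow> P y"
      using P unfolding L(1) eventually_at_left_field by blast
    define c where "c = max b 0"
    have c: "c \<in> {0..1}" "c < p" "b \<le> c" unfolding c_def using b L by auto
    have hc: "h c \<in> {0..1}" "h c < p"
      using PLo_mem[OF h c(1)] PLo_less_iff[OF h c(1) p] c(2) hp by auto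
    have "P (g x)" if x: "h c < x" "x < p" for x
    proof -
      have "x \<in> {0..1}" using x hc p by auto
      then have "g x < p" "c < g x"
        using PLo_less_iff[OF g(1), of x p] PLo_less_iff[OF g(1), of "h c" x] p hc x g(2) gh[OF c(1)]
        by auto
      then show ?thesis using b(2) c(3) by auto
    qed
    then show ?thesis unfolding L(1) eventually_at_left_field using hc by blast
  qed
qed

text \<open>The germ of \<open>f\<close> at the fixed point \<open>p\<close> is affine. One further
  fixed point in its range of validity forces slope 1.\<close>

lemma eventually_fix_if_frequently:
  assumes F: "one_sided F p" and f: "f \<in> carrier PLo" "f p = p"
    and freq: "\<exists>\<^sub>F x in F. f x = x"
  shows "\<forall>\<^sub>F x in F. f x = x"
proof -
  obtain m where m: "\<forall>\<^sub>F x in F. f x = f p + m * (x - p)"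
    using one_sided_affine[OF F f(1)] .
  then have "\<forall>\<^sub>F x in F. f x = x \<longrightarrow> f x = x \<and> f x = f p + m * (x - p) \<and> x \<noteq> p"
    using one_sided_mem(2)[OF F] by eventually_elim blast
  from frequently_rev_mp[OF freq this]
  obtain x where "f x = x" "f x = f p + m * (x - p)" "x \<noteq> p"
    using frequently_ex by blast
  then have "(m - 1) * (x - p) = 0" using f(2) by (simp add: algebra_simps)
  then have "m = 1" using \<open>x \<noteq> p\<close> by simp
  then show ?thesis using m f(2) by simp
qed

section \<open>Commutators near common fixed points\<close>

abbreviation PLo_commutator :: "(real \<Rightarrow> real) \<Rightarrow> (real \<Rightarrow> real) \<Rightarrow> real \<Rightarrow> real" where
  "PLo_commutator f g \<equiv> f \<otimes>\<^bsub>PLo\<^esub> g \<otimes>\<^bsub>PLo\<^esub> inv\<^bsub>PLo\<^esub> f \<otimes>\<^bsub>PLo\<^esub> inv\<^bsub>PLo\<^esub> g"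

lemma PLo_commutator_apply:
  assumes "f \<in> carrier PLo" "g \<in> carrier PLo" "x \<in> {0..1}"
  shows "PLo_commutator f g x = (inv\<^bsub>PLo\<^esub> g) ((inv\<^bsub>PLo\<^esub> f) (g (f x)))"
  by (simp only: PLo_mult_apply[OF assms(3)])

lemma PLo_commutator_in_derived:
  "f \<in> K \<Longrightarrow> g \<in> K \<Longrightarrow> PLo_commutator f g \<in> derived PLo K"
  unfolding derived_def by (intro generate.incl) blast

text \<open>One-sided germs of piecewise linear maps at a common fixed point are scalings about that
  point, and scalings commute.\<close>

lemma PLo_commutator_eventually_fix:
  assumes F: "one_sided F p" and f: "f \<in> carrier PLo" "f p = p" and g: "g \<in> carrier PLo" "g p = p"
  shows "\<forall>\<^sub>F x in F. PLo_commutator f g x = x"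
proof -
  obtain m where m: "\<forall>\<^sub>F x in F. f x = f p + m * (x - p)"
    using one_sided_affine[OF F f(1)] .
  obtain n where n: "\<forall>\<^sub>F x in F. g x = g p + n * (x - p)"
    using one_sided_affine[OF F g(1)] .
  show ?thesis
    \<comment> \<open>The pullbacks make the affine formula of \<open>f\<close> valid at
      \<open>g x\<close> and that of \<open>g\<close> valid at \<open>f x\<close>.\<close>
    using m n one_sided_pullback[OF F g m] one_sided_pullback[OF F f n] one_sided_mem(2)[OF F]
  proof eventually_elim
    case (elim x)
    then have x: "x \<in> {0..1}" by simp
    have "g (f x) = f (g x)" using elim f(2) g(2) by simp
    then show ?case
      using PLo_inv_apply(1)[OF f(1) PLo_mem[OF g(1) x]] PLo_inv_apply(1)[OF g(1) x]
        PLo_commutator_apply[OF f(1) g(1) x] by simp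
  qed
qed

lemma generate_eventually_fix:
  assumes F: "one_sided F p" and S: "S \<subseteq> carrier PLo" "\<And>s. s \<in> S \<Longrightarrow> \<forall>\<^sub>F x in F. s x = x"
    and k: "k \<in> generate PLo S"
  shows "\<forall>\<^sub>F x in F. k x = x"
  using k
proof (induction rule: generate.induct)
  case one
  show ?case using one_sided_mem(2)[OF F]
    by eventually_elim (simp add: PLo_one_apply del: atLeastAtMost_iff)
next
  case (incl h)
  then show ?case by (rule S(2))
next
  case (inv h)
  then have h: "h \<in> carrier PLo" using S(1) by blast
  show ?case using S(2)[OF inv] one_sided_mem(2)[OF F]
    by eventually_elim (use PLo_inv_fix_iff[OF h] in blast)
next
  case (eng g h)
  show ?case using eng(3,4) one_sided_mem(2)[OF F]
    by eventually_elim (use PLo_mult_apply in presburger)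
qed

lemma derived_eventually_fix:
  assumes F: "one_sided F p" and K: "K \<subseteq> carrier PLo" "\<And>k. k \<in> K \<Longrightarrow> k p = p"
    and c: "c \<in> derived PLo K"
  shows "\<forall>\<^sub>F x in F. c x = x"
proof (rule generate_eventually_fix[OF F _ _ c[unfolded derived_def]])
  show "derived_set PLo K \<subseteq> carrier PLo" by (rule PLo.derived_set_in_carrier[OF K(1)])
  show "\<forall>\<^sub>F x in F. h x = x" if "h \<in> derived_set PLo K" for h
    using that PLo_commutator_eventually_fix[OF F] K by blast
qed

section \<open>Solvability and groups trivial near the ends of an orbital\<close>

lemma solvable_seq_subset:
  assumes "subgroup K PLo" "K \<subseteq> H" "solvable_seq PLo H"
  shows "solvable_seq PLo K"
proof -
  obtain n where n: "(derived PLo ^^ n) H = {\<one>\<^bsub>PLo\<^esub>}"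
    using PLo.solvable_imp_trivial_derived_seq[OF assms(3)] by blast
  have "(derived PLo ^^ n) K = {\<one>\<^bsub>PLo\<^esub>}"
    using PLo.mono_exp_of_derived[OF assms(2), of n] n
      subgroup.one_closed[OF PLo.exp_of_derived_is_subgroup[OF assms(1), of n]] by auto
  then show ?thesis by (rule PLo.trivial_derived_seq_imp_solvable[OF assms(1)])
qed

text \<open>The neighbourhoods of \<open>p\<close> and \<open>q\<close> may depend on
  \<open>k\<close>, so no single compact subinterval has to contain the supports of all
  elements.\<close>

definition compactly_supported :: "(real \<Rightarrow> real) set \<Rightarrow> real \<Rightarrow> real \<Rightarrow> bool" where
  "compactly_supported K p q \<longleftrightarrow>
     (\<forall>k\<in>K. (\<forall>\<^sub>F x in at_right p. k x = x) \<and> (\<forall>\<^sub>F x in at_left q. k x = x))"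

lemma compact_support_obtain:
  assumes "p < q" "k p = p" "k q = q"
    and "\<forall>\<^sub>F x in at_right p. k x = x" "\<forall>\<^sub>F x in at_left q. k x = (x::real)"
  obtains s t where "p < s" "s < t" "t < q"
    "\<forall>x\<in>{p..s}. k x = x" "\<forall>x\<in>{t..q}. k x = x"
proof -
  obtain a b where a: "a < q" "\<forall>y>a. y < q \<longrightarrow> k y = y" and b: "p < b" "\<forall>y>p. y < b \<longrightarrow> k y = y"
    using assms(4,5) unfolding eventually_at_left_field eventually_at_right_field by blast
  define m where "m = (p + q) / 2"
  have m: "p < m" "m < q" using assms(1) by (auto simp: m_def)
  define s where "s = (p + min b m) / 2"
  define t where "t = (q + max a m) / 2"
  have s: "p < s" "s < b" "s < m"
    unfolding s_def using b(1) m by (auto simp: min_def)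
  have t: "t < q" "a < t" "m < t"
    unfolding t_def using a(1) m by (auto simp: max_def)
  show thesis
  proof (rule that[of s t])
    show "\<forall>x\<in>{p..s}. k x = x"
      using b(2) s assms(2) by (metis atLeastAtMost_iff le_less le_less_trans)
    show "\<forall>x\<in>{t..q}. k x = x"
      using a(2) t assms(3) by (metis atLeastAtMost_iff le_less less_le_trans)
  qed (use s t in auto)
qed

text \<open>Suppose that the derived subgroup fixes \<open>y\<close>, and let \<open>g\<close> move
  \<open>y\<close>. The support of \<open>g\<close> in the orbital lies between \<open>s\<close> and
  \<open>t\<close>, and some \<open>m\<close> carries this stretch to the left of \<open>s\<close>,
  where \<open>g\<close> is the identity. Then the commutator of \<open>m\<close> and
  \<open>g\<close> acts at \<open>y\<close> as the inverse of \<open>g\<close>, which moves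
  \<open>y\<close>.\<close>

lemma orbital_interval_derived:
  assumes K: "orbital_interval K p q" and supp: "compactly_supported K p q"
  shows "orbital_interval (derived PLo K) p q"
proof -
  note D = orbital_intervalD[OF K]
  have sub: "derived PLo K \<subseteq> K" using PLo.derived_incl[OF subset_refl D(1)] .
  have "\<exists>c\<in>derived PLo K. c y \<noteq> y" if y: "y \<in> {p<..<q}" for y
  proof (rule ccontr)
    assume "\<not> ?thesis"
    then have fixed: "c y = y" if "c \<in> derived PLo K" for c using that by blast
    note y01 = D(11)[OF y]
    obtain g where g: "g \<in> K" "g y \<noteq> y" using D(10)[OF y] by blast
    have "\<forall>\<^sub>F x in at_right p. g x = x" "\<forall>\<^sub>F x in at_left q. g x = x"
      using supp g(1) unfolding compactly_supported_def by blast+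
    from compact_support_obtain[OF D(3) D(7,8)[OF g(1)] this]
    obtain s t where st: "p < s" "s < t" "t < q"
      "\<forall>x\<in>{p..s}. g x = x" "\<forall>x\<in>{t..q}. g x = x" .
    have yst: "s < y" "y < t" using st(4,5) g(2) y by force+
    obtain l where l: "l \<in> K" "t < l s"
      using orbital_interval_push_right[OF K, of s t] st by auto
    define m where "m = inv\<^bsub>PLo\<^esub> l"
    have m: "m \<in> K" unfolding m_def using subgroup.m_inv_closed[OF D(1) l(1)] .
    have lc: "l \<in> carrier PLo" and gc: "g \<in> carrier PLo" and mc: "m \<in> carrier PLo"
      using D(9) l(1) g(1) m by auto
    have s01: "s \<in> {0..1}" using D(11)[of s] st by auto
    have lm: "l (m y) = y" unfolding m_def using PLo_inv_apply(2)[OF lc y01] .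
    have my: "m y \<in> {p<..<q}" using orbital_interval_mem[OF K m y] .
    have "m y < s"
      using PLo_less_iff[OF lc D(11)[OF my] s01] lm yst l(2) by simp
    then have gmy: "g (m y) = m y" using st(4) my by simp
    have "PLo_commutator m g y = (inv\<^bsub>PLo\<^esub> g) ((inv\<^bsub>PLo\<^esub> m) (g (m y)))"
      using PLo_commutator_apply[OF mc gc y01] .
    also have "\<dots> = (inv\<^bsub>PLo\<^esub> g) y"
      unfolding gmy using PLo_inv_apply(1)[OF mc y01] by simp
    finally have "(inv\<^bsub>PLo\<^esub> g) y = y"
      using fixed[OF PLo_commutator_in_derived[OF m g(1)]] by simp
    then show False using PLo_inv_fix_iff[OF gc y01] g(2) by simp
  qed
  then show ?thesis
    unfolding orbital_interval_def
    using PLo.derived_is_subgroup[OF subgroup.subset[OF D(1)]] D(2-4) D(7,8) sub by blast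
qed

text \<open>Both hypotheses pass to the derived subgroup, so every term of the derived series keeps
  the orbital \<open>(p, q)\<close> and none is trivial.\<close>

lemma not_solvable_compactly_supported:
  assumes K: "orbital_interval K p q" and supp: "compactly_supported K p q"
  shows "\<not> solvable_seq PLo K"
proof
  assume "solvable_seq PLo K"
  then obtain n where n: "(derived PLo ^^ n) K = {\<one>\<^bsub>PLo\<^esub>}"
    using PLo.solvable_imp_trivial_derived_seq by blast
  have "orbital_interval ((derived PLo ^^ i) K) p q \<and> compactly_supported ((derived PLo ^^ i) K) p q" for i
  proof (induction i)
    case 0
    show ?case using K supp by simp
  next
    case (Suc i)
    define L where "L = (derived PLo ^^ i) K"
    have L: "orbital_interval L p q" "compactly_supported L p q" using Suc unfolding L_def by auto
    have "derived PLo L \<subseteq> L"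
      using PLo.derived_incl[OF subset_refl orbital_intervalD(1)[OF L(1)]] .
    then have "compactly_supported (derived PLo L) p q"
      using L(2) unfolding compactly_supported_def by blast
    then show ?case using orbital_interval_derived[OF L] unfolding L_def by simp
  qed
  then have one: "orbital_interval {\<one>\<^bsub>PLo\<^esub>} p q" using n by metis
  have "(p + q) / 2 \<in> {p<..<q}" using orbital_intervalD(3)[OF one] by auto
  from orbital_intervalD(10,11)[OF one this] show False
    using PLo_one_apply by blast
qed

lemma orbital_interval_one_sided:
  assumes "orbital_interval K p q"
  shows "one_sided (at_right p) p" "one_sided (at_left q) q"
  using orbital_intervalD(2-4)[OF assms] unfolding one_sided_def by auto

lemma compactly_supported_derived:
  assumes "orbital_interval K p q"
  shows "compactly_supported (derived PLo K) p q"
proof -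
  note D = orbital_intervalD[OF assms]
  have K: "K \<subseteq> carrier PLo" using D(9) by blast
  have "\<forall>\<^sub>F x in at_right p. c x = x" "\<forall>\<^sub>F x in at_left q. c x = x" if "c \<in> derived PLo K" for c
    by (rule derived_eventually_fix[OF _ K _ that];
        use D(7,8) orbital_interval_one_sided[OF assms] in blast)+
  then show ?thesis unfolding compactly_supported_def by blast
qed

text \<open>A commutator fixing \<open>y\<close> means that \<open>f\<close> and \<open>g\<close>
  commute at \<open>y\<close>, so \<open>g (f y) = f (g y) = f y\<close>.\<close>

lemma commutator_fix_transfer:
  assumes f: "f \<in> carrier PLo" and g: "g \<in> carrier PLo" and y: "y \<in> {0..1}"
    and c: "PLo_commutator f g y = y" and gy: "g y = y"
  shows "g (f y) = f y"
proof -
  have fy: "f y \<in> {0..1}" "g (f y) \<in> {0..1}"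
    using PLo_mem[OF f y] PLo_mem[OF g PLo_mem[OF f y]] by auto
  have z: "(inv\<^bsub>PLo\<^esub> f) (g (f y)) \<in> {0..1}"
    using PLo_mem[OF PLo.inv_closed[OF f] fy(2)] .
  have "(inv\<^bsub>PLo\<^esub> g) ((inv\<^bsub>PLo\<^esub> f) (g (f y))) = y"
    using PLo_commutator_apply[OF f g y] c by simp
  then have "(inv\<^bsub>PLo\<^esub> f) (g (f y)) = y"
    using PLo_inv_apply(2)[OF g z] gy by simp
  then show ?thesis using PLo_inv_apply(2)[OF f fy(2)] by simp
qed

text \<open>If the derived subgroup still has the orbital \<open>(p, q)\<close>, it is trivial near
  the ends, because commutator germs at \<open>p\<close> and \<open>q\<close> vanish, and is not
  solvable. Otherwise the derived subgroup has a fixed point inside; this makes every generator, and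
  so the whole group, trivial near the ends.\<close>

lemma not_solvable_generated_with_fixpoints:
  assumes S: "S \<subseteq> carrier PLo" and K: "orbital_interval (generate PLo S) p q"
    and fixpt: "\<And>s. s \<in> S \<Longrightarrow> \<exists>x\<in>{p<..<q}. s x = x"
  shows "\<not> solvable_seq PLo (generate PLo S)"
proof (cases "orbital_interval (derived PLo (generate PLo S)) p q")
  case True
  note D = orbital_intervalD[OF K]
  have "\<not> solvable_seq PLo (derived PLo (generate PLo S))"
    by (rule not_solvable_compactly_supported[OF True compactly_supported_derived[OF K]])
  then show ?thesis
    using solvable_seq_subset[OF orbital_intervalD(1)[OF True]
        PLo.derived_incl[OF subset_refl D(1)]] by blast
next
  case False
  define K where "K = generate PLo S"
  have K: "orbital_interval K p q" unfolding K_def by fact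
  note D = orbital_intervalD[OF K]
  have S_K: "S \<subseteq> K" unfolding K_def using generate.incl by fast
  have sub: "derived PLo K \<subseteq> K" using PLo.derived_incl[OF subset_refl D(1)] .
  \<comment> \<open>The supremum of the orbit under \<open>s\<close> of a point of \<open>Z\<close> to the left of a fixed point of \<open>s\<close> is
    a fixed point of \<open>s\<close> in \<open>Z\<close>. As \<open>K\<close> acts on \<open>Z\<close> through an abelian quotient, \<open>s\<close> then fixes a
    whole \<open>K\<close>-orbit, which accumulates at \<open>p\<close> and \<open>q\<close>.\<close>
  define Z where "Z = {y \<in> {p<..<q}. \<forall>c\<in>derived PLo K. c y = y}"
  have dK: "subgroup (derived PLo K) PLo"
    using PLo.derived_is_subgroup[OF subgroup.subset[OF D(1)]] .
  have "\<not> (\<forall>x\<in>{p<..<q}. \<exists>c\<in>derived PLo K. c x \<noteq> x)"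
    using False dK D(2-4) D(7,8) sub unfolding K_def[symmetric] orbital_interval_def by blast
  then obtain y0 where y0: "y0 \<in> Z" unfolding Z_def by blast
  have transfer: "s (k y) = k y" if "y \<in> Z" "s \<in> K" "k \<in> K" "s y = y" for y s k
    using that commutator_fix_transfer[OF D(9)[OF that(3)] D(9)[OF that(2)] D(11)]
      PLo_commutator_in_derived[OF that(3,2)] unfolding Z_def by blast
  have Z_inv: "k y \<in> Z" if "y \<in> Z" "k \<in> K" for y k
    using that transfer[OF that(1) _ that(2)] sub orbital_interval_mem[OF K that(2)]
    unfolding Z_def by blast
  have "\<exists>w\<in>Z. s w = w" if s: "s \<in> S" for s
  proof -
    have sK: "s \<in> K" and sc: "s \<in> carrier PLo" using s S S_K by auto
    obtain x where x: "x \<in> {p<..<q}" "s x = x" using fixpt[OF s] by blast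
    note x01 = D(11)[OF x(1)]
    obtain k where k: "k \<in> K" "k y0 < x"
      using orbital_interval_push_left[OF K, of y0 x] y0 x unfolding Z_def by auto
    define z where "z = k y0"
    have z: "z \<in> Z" "z < x" unfolding z_def using Z_inv[OF y0 k(1)] k(2) by auto
    have z01: "z \<in> {0..1}" using z(1) D(11) unfolding Z_def by blast
    define C where "C = generate PLo {s}"
    have C: "subgroup C PLo" unfolding C_def using PLo.generate_is_subgroup sc by simp
    have CK: "C \<subseteq> K" unfolding C_def using PLo.generate_subgroup_incl[of "{s}"] sK D(1) by simp
    have sC: "s \<in> C" unfolding C_def by (simp add: generate.incl)
    define w where "w = Sup (orbit_set C z)"
    note O = orbit_set_bounds[OF C z01]
    have w: "w \<in> {0..1}" "s w = w"
      unfolding w_def using Sup_orbit_fixed[OF C z01 sC] by auto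
    have "o' \<le> x" if o': "o' \<in> orbit_set C z" for o'
    proof -
      obtain c where c: "c \<in> C" "o' = c z" using o' by blast
      have "c x = x"
        using generate_fix[of "{s}" x c] c(1) x x01 sc unfolding C_def by auto
      then show ?thesis
        using PLo_le_iff[OF D(9) z01 x01, of c] c CK z(2) by auto
    qed
    then have "w \<le> x" unfolding w_def using O(1) by (intro cSup_least) auto
    moreover have "z \<le> w" unfolding w_def using O by (intro cSup_upper)
    ultimately have wpq: "w \<in> {p<..<q}" using z x(1) unfolding Z_def by auto
    \<comment> \<open>\<open>Z\<close> is invariant under \<open>K\<close>, so \<open>w\<close> is a
      supremum of points fixed by \<open>c\<close>. Monotonicity bounds each of them by
      \<open>c w\<close>; applying this to the inverse of \<open>c\<close> as well shows that
      \<open>c\<close> fixes \<open>w\<close>.\<close>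
    have le: "w \<le> c w" if c: "c \<in> derived PLo K" for c
      unfolding w_def
    proof (rule cSup_least)
      fix o' assume o': "o' \<in> orbit_set C z"
      then have "o' \<in> Z" using Z_inv[OF z(1)] CK by blast
      then have co: "c o' = o'" using c unfolding Z_def by blast
      have "o' \<le> w" unfolding w_def using o' O(3) by (intro cSup_upper)
      moreover have "o' \<in> {0..1}" "c \<in> carrier PLo" using o' O(2) c sub D(9) by blast+
      ultimately have "c o' \<le> c w" using PLo_le_iff w(1) by blast
      then show "o' \<le> c (Sup (orbit_set C z))" using co unfolding w_def[symmetric] by simp
    qed (use O(1) in blast)
    have "c w = w" if c: "c \<in> derived PLo K" for c
    proof (rule antisym)
      have cc: "c \<in> carrier PLo" and ic: "inv\<^bsub>PLo\<^esub> c \<in> derived PLo K"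
        using c sub D(9) subgroup.m_inv_closed[OF dK c] by auto
      show "w \<le> c w" by (rule le[OF c])
      have "c w \<le> c ((inv\<^bsub>PLo\<^esub> c) w)"
        using PLo_le_iff[OF cc w(1) PLo_mem[OF PLo.inv_closed[OF cc] w(1)]] le[OF ic] by blast
      then show "c w \<le> w" using PLo_inv_apply(2)[OF cc w(1)] by simp
    qed
    then have "w \<in> Z" using wpq unfolding Z_def by blast
    then show ?thesis using w(2) by blast
  qed
  note Z_fix = this
  have freq: "\<forall>\<^sub>F x in at_right p. s x = x" "\<forall>\<^sub>F x in at_left q. s x = x" if s: "s \<in> S" for s
  proof -
    have sK: "s \<in> K" and sc: "s \<in> carrier PLo" using s S S_K by auto
    obtain w where w: "w \<in> Z" "s w = w" using Z_fix[OF s] by blast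
    have wpq: "w \<in> {p<..<q}" using w(1) unfolding Z_def by blast
    have fixed: "s (k w) = k w" "k w \<in> {p<..<q}" if "k \<in> K" for k
      using transfer[OF w(1) sK that w(2)] orbital_interval_mem[OF K that wpq] by auto
    \<comment> \<open>The \<open>K\<close>-orbit of \<open>w\<close> consists of fixed points of
      \<open>s\<close> and comes arbitrarily close to \<open>p\<close>.\<close>
    have "\<exists>\<^sub>F x in at_right p. s x = x"
      unfolding frequently_def eventually_at_right_field
      using orbital_interval_push_left[OF K wpq] fixed by (metis greaterThanLessThan_iff)
    then show "\<forall>\<^sub>F x in at_right p. s x = x"
      using eventually_fix_if_frequently[OF orbital_interval_one_sided(1)[OF K] sc D(7)[OF sK]] by blast
    have "\<exists>\<^sub>F x in at_left q. s x = x"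
      unfolding frequently_def eventually_at_left_field
      using orbital_interval_push_right[OF K wpq] fixed by (metis greaterThanLessThan_iff)
    then show "\<forall>\<^sub>F x in at_left q. s x = x"
      using eventually_fix_if_frequently[OF orbital_interval_one_sided(2)[OF K] sc D(8)[OF sK]] by blast
  qed
  have "\<forall>\<^sub>F x in at_right p. k x = x" "\<forall>\<^sub>F x in at_left q. k x = x" if "k \<in> K" for k
    by (rule generate_eventually_fix[OF _ S _ that[unfolded K_def]];
        use freq orbital_interval_one_sided[OF K] in blast)+
  then have "compactly_supported K p q" unfolding compactly_supported_def by blast
  then show ?thesis
    using not_solvable_compactly_supported[OF K] unfolding K_def by blast
qed

section \<open>Orbitals of elements and the derived subgroup\<close>

lemma open_interval_eq_iff:
  fixes a b c d :: real
  assumes "a < b"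
  shows "{a<..<b} = {c<..<d} \<longleftrightarrow> a = c \<and> b = d"
  using assms greaterThanLessThan_subseteq_greaterThanLessThan[of a b c d]
    greaterThanLessThan_subseteq_greaterThanLessThan[of c d a b]
  by (metis antisym greaterThanLessThan_empty_iff linorder_not_le subset_refl)

lemma orbital_in_derived_subgroup:
  assumes G: "subgroup G PLo" and solv: "solvable_seq PLo G"
    and gh: "g \<in> G" "h \<in> G" and A: "A \<in> elem_orbitals g" and B: "B \<in> elem_orbitals h"
    and AB: "A \<subset> B"
  shows "\<exists>k\<in>derived PLo G. A \<in> elem_orbitals k"
proof -
  have gc: "g \<in> carrier PLo" and hc: "h \<in> carrier PLo"
    using gh subgroup.mem_carrier[OF G] by auto
  obtain a b where A_eq: "A = {a<..<b}" and a: "0 \<le> a" "a < b" "b \<le> 1" "g a = a" "g b = b"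
    "\<forall>x\<in>{a<..<b}. g x \<noteq> x"
    using A elem_orbitals_iff[OF gc] by auto
  obtain c d where B_eq: "B = {c<..<d}" and c: "0 \<le> c" "c < d" "d \<le> 1" "h c = c" "h d = d"
    "\<forall>x\<in>{c<..<d}. h x \<noteq> x"
    using B elem_orbitals_iff[OF hc] by auto
  have le: "c \<le> a" "b \<le> d"
    using AB a(2) greaterThanLessThan_subseteq_greaterThanLessThan[of a b c d]
    unfolding A_eq B_eq by auto
  \<comment> \<open>Strict inclusion leaves an end of \<open>A\<close> inside \<open>B\<close>; this
    end is the fixed point \<open>e\<close> of \<open>g\<close>.\<close>
  have "c < a \<or> b < d" using AB le unfolding A_eq B_eq by force
  then obtain e where e: "e \<in> {c<..<d}" "g e = e"
    using le a by (metis greaterThanLessThan_iff le_less_trans less_le_trans)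
  define K where "K = generate PLo {g, h}"
  have K: "subgroup K PLo" unfolding K_def using PLo.generate_is_subgroup gc hc by simp
  have gK: "g \<in> K" and hK: "h \<in> K" unfolding K_def by (simp_all add: generate.incl)
  have KG: "K \<subseteq> G" unfolding K_def using PLo.generate_subgroup_incl[OF _ G, of "{g, h}"] gh by simp
  define x where "x = (c + d) / 2"
  have x: "x \<in> {c<..<d}" using c(2) unfolding x_def by auto
  have x01: "x \<in> {0..1}" using x c by auto
  \<comment> \<open>This orbital contains \<open>B\<close>, since \<open>h\<close> fixes
    \<open>p\<close> and \<open>q\<close> but no point of \<open>B\<close>. It equals
    \<open>B\<close>: otherwise both generators of \<open>K\<close> would have fixed points in it,
    contradicting solvability.\<close>
  obtain p q where pq: "orbital_interval K p q" and xpq: "x \<in> {p<..<q}"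
    using orbital_interval_exists[OF K x01 hK] c(6) x by blast
  note P = orbital_intervalD[OF pq]
  have "h p = p" "h q = q" using P(7,8) hK by auto
  then have "p \<le> c" "d \<le> q" using c(6) x xpq by force+
  have "\<not> (\<exists>y\<in>{p<..<q}. h y = y)"
  proof
    assume "\<exists>y\<in>{p<..<q}. h y = y"
    moreover have "e \<in> {p<..<q}" using e \<open>p \<le> c\<close> \<open>d \<le> q\<close> by auto
    ultimately have "\<not> solvable_seq PLo K"
      unfolding K_def
      by (intro not_solvable_generated_with_fixpoints[of _ p q])
        (use pq gc hc e in \<open>auto simp: K_def\<close>)
    then show False using solvable_seq_subset[OF K KG solv] by blast
  qed
  then have "c \<notin> {p<..<q}" "d \<notin> {p<..<q}" using c by auto
  then have "p = c" "q = d" using \<open>p \<le> c\<close> \<open>d \<le> q\<close> c(2) x xpq by auto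
  then have cd: "orbital_interval K c d" using pq by simp
  note D = orbital_intervalD[OF cd]
  have conj_apply: "(k \<otimes>\<^bsub>PLo\<^esub> g \<otimes>\<^bsub>PLo\<^esub> inv\<^bsub>PLo\<^esub> k) y = (inv\<^bsub>PLo\<^esub> k) (g (k y))" if "y \<in> {0..1}" for k y
    by (simp only: PLo_mult_apply[OF that])
  \<comment> \<open>\<open>N\<close> is the normal closure of \<open>g\<close> in \<open>K\<close>.
    Each conjugate fixes a translate of \<open>e\<close> in \<open>B\<close>, so \<open>B\<close>
    cannot be an orbital of the solvable group \<open>N\<close>, and \<open>N\<close> has a common
    fixed point \<open>y\<close> in \<open>B\<close>.\<close>
  define S where "S = (\<lambda>k. k \<otimes>\<^bsub>PLo\<^esub> g \<otimes>\<^bsub>PLo\<^esub> inv\<^bsub>PLo\<^esub> k) ` K"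
  define N where "N = generate PLo S"
  have SK: "S \<subseteq> K"
    unfolding S_def using gK subgroup.m_closed[OF K] subgroup.m_inv_closed[OF K] by blast
  have Sc: "S \<subseteq> carrier PLo" using SK D(9) by blast
  have N: "subgroup N PLo" unfolding N_def by (rule PLo.generate_is_subgroup[OF Sc])
  have NK: "N \<subseteq> K" unfolding N_def by (rule PLo.generate_subgroup_incl[OF SK K])
  have "\<not> orbital_interval N c d"
  proof
    assume "orbital_interval N c d"
    moreover have "\<exists>y\<in>{c<..<d}. s y = y" if s: "s \<in> S" for s
    proof -
      obtain k where k: "k \<in> K" "s = k \<otimes>\<^bsub>PLo\<^esub> g \<otimes>\<^bsub>PLo\<^esub> inv\<^bsub>PLo\<^esub> k" using s unfolding S_def by blast
      define y where "y = (inv\<^bsub>PLo\<^esub> k) e"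
      have y: "y \<in> {c<..<d}"
        unfolding y_def using orbital_interval_mem[OF cd subgroup.m_inv_closed[OF K k(1)] e(1)] .
      have "k y = e" unfolding y_def using PLo_inv_apply(2)[OF D(9)[OF k(1)] D(11)[OF e(1)]] .
      then have "s y = y" using conj_apply[OF D(11)[OF y], of k] k(2) e(2) y_def by simp
      then show ?thesis using y by blast
    qed
    ultimately have "\<not> solvable_seq PLo N"
      unfolding N_def using not_solvable_generated_with_fixpoints[OF Sc] by blast
    then show False using solvable_seq_subset[OF N _ solv] NK KG by blast
  qed
  then obtain y where y: "y \<in> {c<..<d}" "\<forall>n\<in>N. n y = y"
    using N NK D(2-4) D(7,8) unfolding orbital_interval_def by blast
  \<comment> \<open>All conjugates of \<open>g\<close> fix \<open>y\<close>, so \<open>g\<close>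
    fixes the whole \<open>K\<close>-orbit of \<open>y\<close>. This orbit accumulates at
    \<open>c\<close> and \<open>d\<close>, which makes \<open>g\<close> trivial near both.\<close>
  have g_fix: "g (k y) = k y" "k y \<in> {c<..<d}" if k: "k \<in> K" for k
  proof -
    note kc = D(9)[OF k] and y01 = D(11)[OF y(1)]
    have "k \<otimes>\<^bsub>PLo\<^esub> g \<otimes>\<^bsub>PLo\<^esub> inv\<^bsub>PLo\<^esub> k \<in> N"
      unfolding N_def S_def using k by (intro generate.incl) blast
    then have "(k \<otimes>\<^bsub>PLo\<^esub> g \<otimes>\<^bsub>PLo\<^esub> inv\<^bsub>PLo\<^esub> k) y = y" using y(2) by blast
    then have "(inv\<^bsub>PLo\<^esub> k) (g (k y)) = y" unfolding conj_apply[OF y01] .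
    then show "g (k y) = k y"
      using PLo_inv_apply(2)[OF kc PLo_mem[OF gc PLo_mem[OF kc y01]]] by simp
    show "k y \<in> {c<..<d}" using orbital_interval_mem[OF cd k y(1)] .
  qed
  have "\<exists>\<^sub>F x in at_right c. g x = x"
    unfolding frequently_def eventually_at_right_field
    using orbital_interval_push_left[OF cd y(1)] g_fix by (metis greaterThanLessThan_iff)
  then have "\<forall>\<^sub>F x in at_right c. g x = x"
    using eventually_fix_if_frequently[OF orbital_interval_one_sided(1)[OF cd] gc D(7)[OF gK]] by blast
  moreover have "\<exists>\<^sub>F x in at_left d. g x = x"
    unfolding frequently_def eventually_at_left_field
    using orbital_interval_push_right[OF cd y(1)] g_fix by (metis greaterThanLessThan_iff)
  then have "\<forall>\<^sub>F x in at_left d. g x = x"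
    using eventually_fix_if_frequently[OF orbital_interval_one_sided(2)[OF cd] gc D(8)[OF gK]] by blast
  ultimately obtain s t where st: "c < s" "s < t" "t < d"
      "\<forall>x\<in>{c..s}. g x = x" "\<forall>x\<in>{t..d}. g x = x"
    using compact_support_obtain[OF D(3) D(7,8)[OF gK]] by blast
  have "s \<le> a"
  proof (rule ccontr)
    assume "\<not> s \<le> a"
    then obtain z where "a < z" "z < min s b" using dense[of a "min s b"] a by auto
    then have "z \<in> {c..s}" "z \<in> {a<..<b}" using le by auto
    then show False using st(4) a(6) by blast
  qed
  have "b \<le> t"
  proof (rule ccontr)
    assume "\<not> b \<le> t"
    then obtain z where "max a t < z" "z < b" using dense[of "max a t" b] a by auto
    then have "z \<in> {t..d}" "z \<in> {a<..<b}" using le by auto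
    then show False using st(5) a(6) by blast
  qed
  obtain k where k: "k \<in> K" "t < k s"
    using orbital_interval_push_right[OF cd, of s t] st by auto
  \<comment> \<open>The commutator of \<open>g'\<close> and \<open>k'\<close> applies
    \<open>g'\<close>, \<open>k'\<close>, \<open>g\<close>, \<open>k\<close> in this order. From
    \<open>{a..b}\<close>, \<open>g'\<close> stays in \<open>{a..b}\<close>, \<open>k'\<close> moves
    the point left of \<open>s\<close>, where \<open>g\<close> does nothing, and \<open>k\<close>
    brings it back; what remains is \<open>g'\<close>.\<close>
  define k' where "k' = inv\<^bsub>PLo\<^esub> k"
  define g' where "g' = inv\<^bsub>PLo\<^esub> g"
  note kc = D(9)[OF k(1)]
  have k': "k' \<in> K" "k' \<in> G" and k'c: "k' \<in> carrier PLo"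
    unfolding k'_def using subgroup.m_inv_closed[OF K k(1)] KG kc by auto
  have g': "g' \<in> G" and g'c: "g' \<in> carrier PLo"
    unfolding g'_def using subgroup.m_inv_closed[OF G gh(1)] gc by auto
  have comm: "PLo_commutator g' k' z = g' z" if z: "z \<in> {a..b}" for z
  proof -
    have z01: "z \<in> {0..1}" and a01: "a \<in> {0..1}" and b01: "b \<in> {0..1}" using z a by auto
    define u where "u = g' z"
    have "g' a = a" "g' b = b"
      unfolding g'_def using PLo_inv_fix_iff[OF gc] a01 b01 a(4,5) by auto
    then have "a \<le> u" "u \<le> b"
      unfolding u_def using PLo_le_iff[OF g'c a01 z01] PLo_le_iff[OF g'c z01 b01] z by auto
    then have u: "u \<in> {c<..<d}" "u \<le> t" using \<open>s \<le> a\<close> \<open>b \<le> t\<close> st by auto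
    have k'u: "k' u \<in> {c<..<d}" using orbital_interval_mem[OF cd k'(1) u(1)] .
    have ku: "k (k' u) = u" unfolding k'_def using PLo_inv_apply(2)[OF kc D(11)[OF u(1)]] .
    have "s \<in> {0..1}" using D(11) st by auto
    then have "k' u < s"
      using PLo_less_iff[OF kc D(11)[OF k'u], of s] k(2) u(2) ku by simp
    then have "g (k' u) = k' u" using st(4) k'u by auto
    then show ?thesis
      using PLo_commutator_apply[OF g'c k'c z01] ku gc kc
      unfolding u_def k'_def g'_def by simp
  qed
  have comm_c: "PLo_commutator g' k' \<in> carrier PLo" using g'c k'c by simp
  have g'_iff: "g' z = z \<longleftrightarrow> g z = z" if "z \<in> {0..1}" for z
    unfolding g'_def using PLo_inv_fix_iff[OF gc that] .
  have "PLo_commutator g' k' z \<noteq> z" if "z \<in> {a<..<b}" for z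
    using comm[of z] g'_iff[of z] a that by auto
  moreover have "PLo_commutator g' k' a = a" "PLo_commutator g' k' b = b"
    using comm g'_iff a by auto
  ultimately have "A \<in> elem_orbitals (PLo_commutator g' k')"
    using elem_orbitals_iff[OF comm_c] A_eq a by blast
  then show ?thesis using PLo_commutator_in_derived[OF g' k'(2)] by blast
qed

section \<open>Enlarging an orbital whose ends are not fixed\<close>

lemma larger_orbital_conjugate:
  assumes G: "subgroup G PLo" and g: "g \<in> G" and A: "{a<..<b} \<in> elem_orbitals g" and ab: "a < b"
    and h: "h \<in> G" "h a \<le> a" "b \<le> h b" "h a \<noteq> a \<or> h b \<noteq> b"
  shows "\<exists>k\<in>G. \<exists>B\<in>elem_orbitals k. {a<..<b} \<subset> B"
proof -
  have gc: "g \<in> carrier PLo" and hc: "h \<in> carrier PLo"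
    using g h subgroup.mem_carrier[OF G] by auto
  obtain a' b' where "{a<..<b} = {a'<..<b'}" "0 \<le> a'" "a' < b'" "b' \<le> 1" "g a' = a'" "g b' = b'"
    "\<forall>x\<in>{a'<..<b'}. g x \<noteq> x"
    using A elem_orbitals_iff[OF gc] by auto
  moreover from this have "a = a'" "b = b'" using open_interval_eq_iff[OF ab] by auto
  ultimately have a: "0 \<le> a" "b \<le> 1" "g a = a" "g b = b" "\<forall>x\<in>{a<..<b}. g x \<noteq> x" by auto
  have a01: "a \<in> {0..1}" and b01: "b \<in> {0..1}" using a ab by auto
  define h' where "h' = inv\<^bsub>PLo\<^esub> h"
  have h': "h' \<in> G" and h'c: "h' \<in> carrier PLo"
    unfolding h'_def using subgroup.m_inv_closed[OF G h(1)] hc by auto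
  \<comment> \<open>This conjugate of \<open>g\<close> has the image of \<open>{a<..<b}\<close>
    under \<open>h\<close> as an orbital, and \<open>h\<close> moves the ends weakly outward, at
    least one of them strictly.\<close>
  define k where "k = h' \<otimes>\<^bsub>PLo\<^esub> g \<otimes>\<^bsub>PLo\<^esub> h"
  have k: "k \<in> G" and kc: "k \<in> carrier PLo"
    unfolding k_def using h' g h(1) subgroup.m_closed[OF G] gc hc h'c by auto
  have k_apply: "k x = h (g (h' x))" if "x \<in> {0..1}" for x
    unfolding k_def by (simp only: PLo_mult_apply[OF that])
  have h'h: "h' (h x) = x" "h (h' x) = x" if "x \<in> {0..1}" for x
    unfolding h'_def using PLo_inv_apply[OF hc that] by auto
  have ha: "h a \<in> {0..1}" "h b \<in> {0..1}" using PLo_mem[OF hc] a01 b01 by auto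
  have "k x \<noteq> x" if x: "x \<in> {h a<..<h b}" for x
  proof -
    have x01: "x \<in> {0..1}" using x ha by auto
    have "h' x \<in> {a<..<b}"
      using PLo_less_iff[OF h'c ha(1) x01] PLo_less_iff[OF h'c x01 ha(2)] x h'h a01 b01 by auto
    then have "g (h' x) \<noteq> h' x" using a(5) by blast
    then show ?thesis
      using k_apply[OF x01] h'h(1)[of "g (h' x)"] PLo_mem[OF gc PLo_mem[OF h'c x01]] by auto
  qed
  moreover have "k (h a) = h a" "k (h b) = h b"
    using k_apply ha h'h a01 b01 a by auto
  moreover have "h a < h b" using PLo_less_iff[OF hc a01 b01] ab by simp
  ultimately have "{h a<..<h b} \<in> elem_orbitals k"
    unfolding elem_orbitals_iff[OF kc] using ha by (intro exI[of _ "h a"] exI[of _ "h b"]) auto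
  moreover have "{a<..<b} \<subset> {h a<..<h b}"
    using h ab by (auto simp: psubset_eq greaterThanLessThan_subseteq_greaterThanLessThan
        open_interval_eq_iff)
  ultimately show ?thesis using k by blast
qed

text \<open>Here the image of the orbital under \<open>h\<close> does not contain the orbital, so
  conjugation does not suffice. Instead an element \<open>l\<close> of the group generated by
  \<open>g\<close> first pushes most of the interval so far right that \<open>h\<close> carries it
  past \<open>b\<close>; then \<open>l\<close> followed by \<open>h\<close> moves all of
  \<open>{a..b}\<close> to the right.\<close>

lemma larger_orbital_push:
  assumes G: "subgroup G PLo" and g: "g \<in> G" and A: "{a<..<b} \<in> elem_orbitals g" and ab: "a < b"
    and h: "h \<in> G" "a < h a" "b < h b"
  shows "\<exists>k\<in>G. \<exists>B\<in>elem_orbitals k. {a<..<b} \<subset> B"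
proof -
  have gc: "g \<in> carrier PLo" and hc: "h \<in> carrier PLo"
    using g h subgroup.mem_carrier[OF G] by auto
  obtain a' b' where "{a<..<b} = {a'<..<b'}" and I': "orbital_interval (generate PLo {g}) a' b'"
    using A elem_orbitals_iff[OF gc] orbital_interval_cyclic_iff[OF gc] by auto
  moreover from this have "a = a'" "b = b'" using open_interval_eq_iff[OF ab] by auto
  ultimately have I: "orbital_interval (generate PLo {g}) a b" by simp
  note D = orbital_intervalD[OF I]
  define h' where "h' = inv\<^bsub>PLo\<^esub> h"
  have h'c: "h' \<in> carrier PLo" unfolding h'_def using hc by simp
  have hh': "h (h' b) = b" "h' b \<in> {0..1}"
    unfolding h'_def using PLo_inv_apply(2)[OF hc D(6)] PLo_mem[OF h'c D(6)] h'_def by auto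
  have h'b: "h' b < b" using PLo_less_iff[OF hc hh'(2) D(6)] hh'(1) h(3) by simp
  \<comment> \<open>Points up to \<open>z\<close> are moved beyond \<open>z\<close> by
    \<open>h\<close>, as \<open>z < h a\<close>; points beyond \<open>z\<close> are sent past
    \<open>b\<close> thanks to \<open>l\<close>.\<close>
  obtain z where z: "a < z" "z < min (h a) b" using dense[of a "min (h a) b"] ab h(2) by auto
  have z_ab: "z \<in> {a<..<b}" using z by auto
  obtain l where l: "l \<in> generate PLo {g}" "h' b < l z"
    using orbital_interval_push_right[OF I z_ab h'b] .
  have lG: "l \<in> G" using PLo.generate_subgroup_incl[OF _ G, of "{g}"] g l(1) by auto
  note lc = D(9)[OF l(1)]
  define f where "f = l \<otimes>\<^bsub>PLo\<^esub> h"
  have f: "f \<in> G" "f \<in> carrier PLo"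
    unfolding f_def using subgroup.m_closed[OF G lG h(1)] lc hc by auto
  have f_apply: "f x = h (l x)" if "x \<in> {0..1}" for x
    unfolding f_def by (rule PLo_mult_apply[OF that])
  have f_gt: "x < f x" if x: "x \<in> {a..b}" for x
  proof -
    have x01: "x \<in> {0..1}" using x D(2,4) by auto
    have lx: "l x \<in> {0..1}" by (rule PLo_mem[OF lc x01])
    show ?thesis
    proof (cases "x \<le> z")
      case True
      have "a \<le> l x" using PLo_le_iff[OF lc D(5) x01] D(7)[OF l(1)] x by simp
      then have "h a \<le> h (l x)" using PLo_le_iff[OF hc D(5) lx] by simp
      then show ?thesis using f_apply[OF x01] z True by simp
    next
      case False
      then have "l z \<le> l x" using PLo_le_iff[OF lc D(11)[OF z_ab] x01] by simp
      then have "h (h' b) < h (l x)" using PLo_less_iff[OF hc hh'(2) lx] l(2) by simp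
      then show ?thesis using f_apply[OF x01] hh'(1) x by simp
    qed
  qed
  have F: "subgroup (generate PLo {f}) PLo" "f \<in> generate PLo {f}"
    using PLo.generate_is_subgroup f(2) by (simp_all add: generate.incl)
  obtain p q where pq: "orbital_interval (generate PLo {f}) p q" "a \<in> {p<..<q}"
    using orbital_interval_exists[OF F(1) D(5) F(2)] f_gt[of a] ab by auto
  \<comment> \<open>A fixed point of \<open>f\<close> above \<open>a\<close> must lie beyond
    \<open>b\<close>.\<close>
  then have "f q = q" using orbital_interval_cyclic_iff[OF f(2)] by simp
  then have "b < q" using f_gt[of q] pq(2) by force
  then have "{a<..<b} \<subset> {p<..<q}"
    using pq(2) ab by (auto simp: psubset_eq greaterThanLessThan_subseteq_greaterThanLessThan
        open_interval_eq_iff)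
  moreover have "{p<..<q} \<in> elem_orbitals f"
    using pq(1) elem_orbitals_iff[OF f(2)] orbital_interval_cyclic_iff[OF f(2)] by blast
  ultimately show ?thesis using f(1) by blast
qed

text \<open>Up to replacing \<open>h\<close> by its inverse, either both ends move weakly outward,
  and conjugation works, or both move strictly to the right, and pushing works.\<close>

lemma larger_orbital:
  assumes G: "subgroup G PLo" and g: "g \<in> G" and A: "{a<..<b} \<in> elem_orbitals g"
    and ab: "a < b" "a \<in> {0..1}" "b \<in> {0..1}"
    and h: "h \<in> G" "h a \<noteq> a \<or> h b \<noteq> b"
  shows "\<exists>k\<in>G. \<exists>B\<in>elem_orbitals k. {a<..<b} \<subset> B"
proof -
  have hc: "h \<in> carrier PLo" using h subgroup.mem_carrier[OF G] by auto
  define h' where "h' = inv\<^bsub>PLo\<^esub> h"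
  have h': "h' \<in> G" and h'c: "h' \<in> carrier PLo"
    unfolding h'_def using subgroup.m_inv_closed[OF G h(1)] hc by auto
  have inv_less: "x < h' x \<longleftrightarrow> h x < x" "h' x < x \<longleftrightarrow> x < h x" if x: "x \<in> {0..1}" for x
    using PLo_less_iff[OF h'c PLo_mem[OF hc x] x] PLo_less_iff[OF h'c x PLo_mem[OF hc x]]
      PLo_inv_apply(1)[OF hc x] unfolding h'_def by auto
  note conj = larger_orbital_conjugate[OF G g A ab(1)] and push = larger_orbital_push[OF G g A ab(1)]
  consider "h a \<le> a" "b \<le> h b" | "a \<le> h a" "h b \<le> b" | "a < h a" "b < h b" | "h a < a" "h b < b"
    by linarith
  then show ?thesis
  proof cases
    case 1
    then show ?thesis using conj[OF h(1)] h(2) by blast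
  next
    case 2
    then have "h' a \<le> a" "b \<le> h' b" "h' a \<noteq> a \<or> h' b \<noteq> b"
      using inv_less[OF ab(2)] inv_less[OF ab(3)] h(2) by auto
    then show ?thesis using conj[OF h'] by blast
  next
    case 3
    then show ?thesis using push[OF h(1)] by blast
  next
    case 4
    then have "a < h' a" "b < h' b"
      using inv_less[OF ab(2)] inv_less[OF ab(3)] by auto
    then show ?thesis using push[OF h'] by blast
  qed
qed

section \<open>Chains of orbitals\<close>

text \<open>The orbitals of a finite tower, with the signing elements forgotten; different members
  may come from different elements.\<close>

definition orbital_chain :: "(real \<Rightarrow> real) set \<Rightarrow> real set set \<Rightarrow> bool" where
  "orbital_chain G C \<longleftrightarrow> finite C \<and> C \<subseteq> \<Union> (elem_orbitals ` G) \<and> (\<forall>A\<in>C. \<forall>B\<in>C. A \<subseteq> B \<or> B \<subseteq> A)"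

lemma orbital_chainD:
  assumes "orbital_chain G C"
  shows "finite C" "\<And>A. A \<in> C \<Longrightarrow> \<exists>g\<in>G. A \<in> elem_orbitals g"
    "\<And>A B. A \<in> C \<Longrightarrow> B \<in> C \<Longrightarrow> A \<subseteq> B \<or> B \<subseteq> A"
  using assms unfolding orbital_chain_def by auto

lemma orbital_chainI:
  assumes "finite C" "\<And>A. A \<in> C \<Longrightarrow> \<exists>g\<in>G. A \<in> elem_orbitals g"
    "\<And>A B. A \<in> C \<Longrightarrow> B \<in> C \<Longrightarrow> A \<subseteq> B \<or> B \<subseteq> A"
  shows "orbital_chain G C"
  using assms unfolding orbital_chain_def by auto

lemma orbital_chain_max:
  assumes "orbital_chain G C" "C \<noteq> {}"
  obtains M where "M \<in> C" "\<And>A. A \<in> C \<Longrightarrow> A \<subseteq> M"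
proof -
  obtain M where M: "M \<in> C" "\<forall>A\<in>C. M \<subseteq> A \<longrightarrow> M = A"
    using finite_has_maximal[of C] assms unfolding orbital_chain_def by blast
  have "A \<subseteq> M" if A: "A \<in> C" for A
  proof -
    have "A \<subseteq> M \<or> M \<subseteq> A" using A M(1) assms(1) unfolding orbital_chain_def by simp
    then show ?thesis using M(2) A by auto
  qed
  then show thesis using that M(1) by metis
qed

text \<open>A tower has one element per orbital, so projecting an \<open>n\<close>-element subset of
  it loses nothing. Conversely any choice of signing elements works: distinct members are compared
  by strict inclusion, and \<open>left_le\<close> is only needed for equal elements.\<close>

lemma tower_iff_orbital_chain:
  "(\<exists>T. tower G T \<and> height_at_least T n) \<longleftrightarrow> (\<exists>C. orbital_chain G C \<and> card C = n)"
proof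
  assume "\<exists>T. tower G T \<and> height_at_least T n"
  then obtain T where T: "tower G T" "height_at_least T n" by blast
  obtain T' where T': "T' \<subseteq> T" "finite T'" "card T' = n"
    using T(2) infinite_arbitrarily_large obtain_subset_with_card_n
    unfolding height_at_least_def by metis
  have "inj_on fst T"
    using T(1) unfolding tower_def inj_on_def by force
  then have inj: "inj_on fst T'" using T'(1) inj_on_subset by blast
  have comp: "fst u \<subseteq> fst v \<or> fst v \<subseteq> fst u" if "u \<in> T'" "v \<in> T'" for u v
    using T(1) T'(1) that unfolding tower_def chain_def signed_orbital_le_def by blast
  have "fst u \<in> \<Union> (elem_orbitals ` G)" if "u \<in> T'" for u
  proof -
    have "u \<in> signed_orbitals G" using T(1) T'(1) that unfolding tower_def by blast
    then show ?thesis by (cases u) (auto simp: signed_orbitals_def)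
  qed
  then have "orbital_chain G (fst ` T')"
    unfolding orbital_chain_def using T'(2) comp by blast
  moreover have "card (fst ` T') = n" using card_image[OF inj] T'(3) by simp
  ultimately show "\<exists>C. orbital_chain G C \<and> card C = n" by blast
next
  assume "\<exists>C. orbital_chain G C \<and> card C = n"
  then obtain C where C: "orbital_chain G C" "card C = n" by blast
  then have "\<forall>A\<in>C. \<exists>g. g \<in> G \<and> A \<in> elem_orbitals g" unfolding orbital_chain_def by blast
  then obtain g where g: "\<And>A. A \<in> C \<Longrightarrow> g A \<in> G \<and> A \<in> elem_orbitals (g A)"
    by metis
  define T where "T = (\<lambda>A. (A, g A)) ` C"
  have "card T = n" unfolding T_def using C(2) by (subst card_image) (auto simp: inj_on_def)
  then have "height_at_least T n" unfolding height_at_least_def by simp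
  moreover have "T \<subseteq> signed_orbitals G"
    unfolding T_def signed_orbitals_def using g by auto
  moreover have "Complete_Partial_Order.chain signed_orbital_le T"
    using C(1) unfolding chain_def T_def orbital_chain_def signed_orbital_le_def left_le_def by auto
  moreover have "\<forall>A\<in>fst ` T. \<exists>!g. (A, g) \<in> T" unfolding T_def by auto
  ultimately show "\<exists>T. tower G T \<and> height_at_least T n" unfolding tower_def by blast
qed

text \<open>Every member other than the largest one \<open>M\<close> lies properly inside
  \<open>M\<close>, so it is an orbital of an element of the derived subgroup. Only \<open>M\<close>
  is lost.\<close>

lemma orbital_chain_derived_down:
  assumes G: "subgroup G PLo" "solvable_seq PLo G"
    and C: "orbital_chain G C" "card C = Suc n"
  obtains D where "orbital_chain (derived PLo G) D" "card D = n"
proof -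
  have "C \<noteq> {}" using C(2) by auto
  then obtain M where M: "M \<in> C" "\<And>A. A \<in> C \<Longrightarrow> A \<subseteq> M"
    using orbital_chain_max[OF C(1)] by blast
  have "\<exists>k\<in>derived PLo G. A \<in> elem_orbitals k" if A: "A \<in> C - {M}" for A
  proof -
    obtain g where g: "g \<in> G" "A \<in> elem_orbitals g" using orbital_chainD(2)[OF C(1)] A by auto
    obtain h where h: "h \<in> G" "M \<in> elem_orbitals h" using orbital_chainD(2)[OF C(1) M(1)] by auto
    have "A \<subset> M" using M(2) A by auto
    then show ?thesis by (rule orbital_in_derived_subgroup[OF G g(1) h(1) g(2) h(2)])
  qed
  then have "orbital_chain (derived PLo G) (C - {M})"
    using orbital_chainD(1,3)[OF C(1)] by (intro orbital_chainI) auto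
  moreover have "card (C - {M}) = n" using C M(1) by simp
  ultimately show thesis by (rule that)
qed

text \<open>Let \<open>M\<close> be the largest member, with left end \<open>a\<close>. If all of
  \<open>G\<close> fixed \<open>a\<close>, the element \<open>g\<close> of the derived subgroup
  would be trivial just right of \<open>a\<close>, inside its own orbital. So some \<open>h\<close>
  moves \<open>a\<close>, and an orbital strictly above \<open>M\<close> can be added.\<close>

lemma orbital_chain_derived_up:
  assumes G: "subgroup G PLo"
    and C: "orbital_chain (derived PLo G) C" "C \<noteq> {}"
  obtains D where "orbital_chain G D" "card D = Suc (card C)"
proof -
  obtain M where M: "M \<in> C" "\<And>A. A \<in> C \<Longrightarrow> A \<subseteq> M"
    using orbital_chain_max[OF C] by blast
  have sub: "derived PLo G \<subseteq> G" using PLo.derived_incl[OF subset_refl G] .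
  obtain g where g: "g \<in> derived PLo G" "M \<in> elem_orbitals g"
    using orbital_chainD(2)[OF C(1) M(1)] by blast
  have gG: "g \<in> G" and gc: "g \<in> carrier PLo"
    using g(1) sub subgroup.mem_carrier[OF G] by auto
  obtain a b where ab: "M = {a<..<b}" "0 \<le> a" "a < b" "b \<le> 1" "\<forall>x\<in>{a<..<b}. g x \<noteq> x"
    using g(2) elem_orbitals_iff[OF gc] by blast
  have a: "one_sided (at_right a) a" using ab unfolding one_sided_def by auto
  have "\<exists>h\<in>G. h a \<noteq> a"
  proof (rule ccontr)
    assume "\<not> ?thesis"
    then have "\<forall>\<^sub>F x in at_right a. g x = x"
      using derived_eventually_fix[OF a subgroup.subset[OF G] _ g(1)] by blast
    then obtain c where c: "a < c" "\<forall>y>a. y < c \<longrightarrow> g y = y"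
      unfolding eventually_at_right_field by blast
    obtain z where "a < z" "z < min b c" using dense[of a "min b c"] ab(3) c(1) by auto
    then have "g z = z" "z \<in> {a<..<b}" using c(2) by auto
    then show False using ab(5) by blast
  qed
  then obtain h where "h \<in> G" "h a \<noteq> a" by blast
  then obtain k B where B: "k \<in> G" "B \<in> elem_orbitals k" "M \<subset> B"
    using larger_orbital[OF G gG _ ab(3), of h] g(2) ab by auto
  have "B \<notin> C" using B(3) M(2) by blast
  then have "card (insert B C) = Suc (card C)"
    using C(1) unfolding orbital_chain_def by simp
  moreover have "orbital_chain G (insert B C)"
  proof (rule orbital_chainI)
    show "finite (insert B C)" using orbital_chainD(1)[OF C(1)] by simp
    show "\<exists>g\<in>G. A \<in> elem_orbitals g" if "A \<in> insert B C" for A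
      using that B(1,2) orbital_chainD(2)[OF C(1)] sub by auto
    show "A \<subseteq> A' \<or> A' \<subseteq> A" if "A \<in> insert B C" "A' \<in> insert B C" for A A'
    proof -
      have "X \<subseteq> B" if "X \<in> C" for X using M(2)[OF that] B(3) by auto
      then show ?thesis using that orbital_chainD(3)[OF C(1)] by (elim insertE) simp_all
    qed
  qed
  ultimately show thesis using that by blast
qed

section \<open>Trivial elements and the derived series\<close>

lemma elem_orbitals_one: "elem_orbitals \<one>\<^bsub>PLo\<^esub> = {}"
proof -
  have False if A: "A \<in> elem_orbitals \<one>\<^bsub>PLo\<^esub>" for A
  proof -
    obtain a b where ab: "0 \<le> a" "a < b" "b \<le> 1" "\<forall>x\<in>{a<..<b}. \<one>\<^bsub>PLo\<^esub> x \<noteq> x"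
      using A elem_orbitals_iff[OF PLo_one_closed] by blast
    obtain x where "a < x" "x < b" using dense ab(2) by blast
    then show False using ab PLo_one_apply[of x] by auto
  qed
  then show ?thesis by blast
qed

lemma elem_orbitals_nonempty:
  assumes g: "g \<in> carrier PLo" "g \<noteq> \<one>\<^bsub>PLo\<^esub>"
  shows "elem_orbitals g \<noteq> {}"
proof -
  obtain x where x: "x \<in> {0..1}" "g x \<noteq> x"
    using PLo_eqI[OF g(1) PLo_one_closed] g(2) PLo_one_apply by metis
  have "subgroup (generate PLo {g}) PLo" "g \<in> generate PLo {g}"
    using PLo.generate_is_subgroup g(1) by (simp_all add: generate.incl)
  then obtain p q where "orbital_interval (generate PLo {g}) p q"
    using orbital_interval_exists x by metis
  then show ?thesis
    unfolding elem_orbitals_def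
    using orbitals_eq[OF \<open>subgroup (generate PLo {g}) PLo\<close>] by blast
qed

text \<open>The derived series formed inside \<open>H\<close> agrees with the one formed in
  \<open>PLo\<close>, term by term.\<close>

lemma solvable_subgroup_iff:
  assumes H: "subgroup H PLo"
  shows "solvable (PLo\<lparr>carrier := H\<rparr>) \<longleftrightarrow> solvable_seq PLo H"
proof -
  interpret H: group "PLo\<lparr>carrier := H\<rparr>" using PLo.subgroup_imp_group[OF H] .
  have "(derived (PLo\<lparr>carrier := H\<rparr>) ^^ n) H = (derived PLo ^^ n) H \<and> (derived PLo ^^ n) H \<subseteq> H" for n
  proof (induction n)
    case (Suc n)
    then show ?case
      using PLo.derived_consistent[OF _ H] PLo.derived_incl[OF _ H] by simp
  qed simp
  then have "solvable (PLo\<lparr>carrier := H\<rparr>) \<longleftrightarrow> (\<exists>n. (derived PLo ^^ n) H = {\<one>\<^bsub>PLo\<^esub>})"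
    using H.solvable_iff_trivial_derived_seq by simp
  then show ?thesis
    using PLo.solvable_imp_trivial_derived_seq PLo.trivial_derived_seq_imp_solvable[OF H] by blast
qed

theorem corollary1p3:
  fixes H :: "(real \<Rightarrow> real) set"
  assumes "subgroup H PLo"
  shows "\<not> solvable (PLo\<lparr>carrier := H\<rparr>) \<longleftrightarrow>
         (\<forall>n::nat. \<exists>T. tower H T \<and> height_at_least T n)"
proof -
  let ?D = "\<lambda>n. (derived PLo ^^ n) H"
  have sub: "subgroup (?D n) PLo" for n
    by (rule PLo.exp_of_derived_is_subgroup[OF assms])
  have "solvable_seq PLo H \<longleftrightarrow> \<not> (\<forall>n. \<exists>C. orbital_chain H C \<and> card C = n)"
  proof
    assume solv: "solvable_seq PLo H"
    then obtain n where n: "?D n = {\<one>\<^bsub>PLo\<^esub>}"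
      using PLo.solvable_imp_trivial_derived_seq by blast
    have "?D i \<subseteq> H" for i
      by (induction i) (use PLo.derived_incl[OF _ assms] in auto)
    then have solv_D: "solvable_seq PLo (?D i)" for i
      using solvable_seq_subset[OF sub _ solv] by blast
    have down: "\<exists>C. orbital_chain (?D i) C \<and> card C = m" if "\<exists>C. orbital_chain H C \<and> card C = i + m" for i m
      using that
    proof (induction i arbitrary: m)
      case (Suc i)
      then obtain C where C: "orbital_chain (?D i) C" "card C = Suc m"
        using Suc.IH[of "Suc m"] Suc.prems unfolding add_Suc_right add_Suc by blast
      obtain D where "orbital_chain (derived PLo (?D i)) D" "card D = m"
        by (rule orbital_chain_derived_down[OF sub solv_D C])
      then show ?case by auto
    qed simp
    \<comment> \<open>Each of the \<open>n\<close> derived steps costs one member, so one member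
      would survive in the trivial group, which has no orbitals.\<close>
    have "\<not> (\<exists>C. orbital_chain H C \<and> card C = n + 1)"
    proof
      assume "\<exists>C. orbital_chain H C \<and> card C = n + 1"
      then obtain C where "orbital_chain {\<one>\<^bsub>PLo\<^esub>} C" "card C = 1" using down[of n 1] n by auto
      then show False unfolding orbital_chain_def by (auto simp: elem_orbitals_one)
    qed
    then show "\<not> (\<forall>n. \<exists>C. orbital_chain H C \<and> card C = n)" by blast
  next
    assume bounded: "\<not> (\<forall>n. \<exists>C. orbital_chain H C \<and> card C = n)"
    show "solvable_seq PLo H"
    proof (rule ccontr)
      assume nsolv: "\<not> solvable_seq PLo H"
      have "\<exists>C. orbital_chain H C \<and> card C = n" for n
      proof (cases n)
        case 0
        then show ?thesis unfolding orbital_chain_def by (intro exI[of _ "{}"]) simp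
      next
        case (Suc m)
        \<comment> \<open>A nontrivial element at depth \<open>m\<close> gives a chain with one
          member. Climbing back to \<open>H\<close> adds one member in each of the \<open>m\<close>
          steps, which makes \<open>Suc m = n\<close> in total.\<close>
        have "?D m \<noteq> {\<one>\<^bsub>PLo\<^esub>}"
          using nsolv PLo.trivial_derived_seq_imp_solvable[OF assms] by blast
        then obtain g where "g \<in> ?D m" "g \<noteq> \<one>\<^bsub>PLo\<^esub>"
          using subgroup.one_closed[OF sub[of m]] by blast
        then obtain A where "A \<in> elem_orbitals g" "g \<in> ?D m"
          using elem_orbitals_nonempty subgroup.mem_carrier[OF sub[of m]] by blast
        then have "orbital_chain (?D m) {A}" unfolding orbital_chain_def by auto
        then have base: "\<exists>C. orbital_chain (?D m) C \<and> card C = Suc 0" by (intro exI[of _ "{A}"]) simp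
        have "\<exists>C. orbital_chain (?D (m - i)) C \<and> card C = Suc i" if "i \<le> m" for i
          using that
        proof (induction i)
          case 0
          then show ?case using base by simp
        next
          case (Suc i)
          have "?D (m - i) = derived PLo (?D (m - Suc i))"
            using Suc.prems by (metis Suc_diff_Suc Suc_le_lessD funpow.simps(2) o_apply)
          then obtain C where "orbital_chain (derived PLo (?D (m - Suc i))) C" "card C = Suc i"
            using Suc by auto
          moreover from this have "C \<noteq> {}" by auto
          ultimately show ?case
            using orbital_chain_derived_up[OF sub] by metis
        qed
        from this[of m] show ?thesis using Suc by simp
      qed
      then show False using bounded by blast
    qed
  qed
  then show ?thesis
    unfolding solvable_subgroup_iff[OF assms] tower_iff_orbital_chain by blast
qed

end
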